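(* Let $n\ge 1$, let $\lambda_1,\dots,\lambda_n\in\mathbb{T}$ be pairwise distinct, let $\alpha_1,\dots,\alpha_n>0$, and let $\mu=\sum_{j=1}^n\alpha_j\delta_{\lambda_j}$. Then a holomorphic function $f$ on $\mathbb{D}$ belongs to $\mathcal{D}(\mu)$ if and only if there exist $g\in H^2$ and a polynomial $p$ with $\deg p\le n-1$ such that $$f(z)=p(z)+\prod_{j=1}^n(z-\lambda_j)\,g(z),\qquad z\in\mathbb{D}.$$ Moreover, $g$ and $p$ are unique, and there is a constant $C=C(n,\mu)>0$, independent of $f$, such that for every $f\in\mathcal{D}(\mu)$ the corresponding $g$ satisfies $$\|g\|_2\le C\,\|f\|_\mu .$$
   Context: $\mathbb{D}=\{z\in\mathbb{C}:|z|<1\}$ and $\mathbb{T}$ is the unit circle; $\delta_\lambda$ is the unit point mass at $\lambda$. $H^2$ is the Hardy space of analytic functions $f(z)=\sum_{k\ge0}a_kz^k$ on $\mathbb{D}$ with $\|f\|_2^2=\sum_{k\ge0}|a_k|^2<\infty$. For a positive finite Borel measure $\mu$ on $\mathbb{T}$, put $P_\mu(z)=\int_{\mathbb{T}}\frac{1-|z|^2}{|\zeta-z|^2}\,d\mu(\zeta)$ for $z\in\mathbb{D}$. The Dirichlet-type space $\mathcal{D}(\mu)$ is the set of holomorphic functions $f$ on $\mathbb{D}$ with $\mathcal{D}_\mu(f):=\int_{\mathbb{D}}|f'(z)|^2P_\mu(z)\,dA(z)<\infty$, where $dA$ is normalized area measure on $\mathbb{D}$. One has $\mathcal{D}(\mu)\subset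 H^2$, and $\mathcal{D}(\mu)$ is a Hilbert space with norm $\|f\|_\mu^2=\|f\|_2^2+\mathcal{D}_\mu(f)$. *)

theory Defs
  imports
    "HOL-Complex_Analysis.Complex_Analysis"
    "HOL-Probability.Giry_Monad"
begin

text \<open>
  Functions on the open unit disc are total functions of type \<open>complex \<Rightarrow> complex\<close>. Their values
  outside the disc are irrelevant, so equality of such functions means equality on the disc.
\<close>

abbreviation disc :: "complex set" where
  "disc \<equiv> ball 0 1"

definition hardy_space :: "(complex \<Rightarrow> complex) set" where
  "hardy_space = {f. f holomorphic_on disc \<and>
     summable (\<lambda>k. (norm (fps_nth (fps_expansion f 0) k))\<^sup>2)}"

definition hardy_norm :: "(complex \<Rightarrow> complex) \<Rightarrow> real" where
  "hardy_norm f = sqrt (\<Sum>k. (norm (fps_nth (fps_expansion f 0) k))\<^sup>2)"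

text \<open>
  Positive Borel measures on the unit circle are measures \<open>\<mu>\<close> with \<open>sets \<mu> = sets circle_borel\<close>.
\<close>

definition circle_borel :: "complex measure" where
  "circle_borel = restrict_space borel (sphere 0 1)"

definition dirac_sum :: "nat \<Rightarrow> (nat \<Rightarrow> real) \<Rightarrow> (nat \<Rightarrow> complex) \<Rightarrow> complex measure" where
  "dirac_sum n a l = measure_of (space circle_borel) (sets circle_borel)
     (\<lambda>A. \<Sum>j=1..n. ennreal (a j) * emeasure (return circle_borel (l j)) A)"

lemma sets_dirac_sum [simp]: "sets (dirac_sum n a l) = sets circle_borel"
  unfolding dirac_sum_def by (rule sets.sets_measure_of_eq)

lemma space_circle_borel [simp]: "space circle_borel = sphere 0 1"
  by (simp add: circle_borel_def space_restrict_space)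

lemma space_dirac_sum [simp]: "space (dirac_sum n a l) = sphere 0 1"
  using sets_eq_imp_space_eq[OF sets_dirac_sum] by simp

text \<open>The set function in the definition of \<open>dirac_sum\<close> is indeed a measure.\<close>

lemma emeasure_dirac_sum:
  assumes "A \<in> sets circle_borel"
  shows "emeasure (dirac_sum n a l) A = (\<Sum>j=1..n. ennreal (a j) * indicator A (l j))"
proof -
  let ?\<nu> = "\<lambda>A. \<Sum>j=1..n. ennreal (a j) * emeasure (return circle_borel (l j)) A"
  have ca: "countably_additive (sets circle_borel) ?\<nu>"
  proof (rule countably_additiveI)
    fix A :: "nat \<Rightarrow> complex set"
    assume A: "range A \<subseteq> sets circle_borel" "disjoint_family A" "\<Union> (range A) \<in> sets circle_borel"
    have "(\<Sum>i. ?\<nu> (A i)) =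
        (\<Sum>j=1..n. \<Sum>i. ennreal (a j) * emeasure (return circle_borel (l j)) (A i))"
      by (intro suminf_sum) auto
    also have "\<dots> = (\<Sum>j=1..n. ennreal (a j) * (\<Sum>i. emeasure (return circle_borel (l j)) (A i)))"
      by simp
    also have "\<dots> = ?\<nu> (\<Union> (range A))"
      using A by (intro sum.cong refl arg_cong2[where f = "(*)"] suminf_emeasure) auto
    finally show "(\<Sum>i. ?\<nu> (A i)) = ?\<nu> (\<Union> (range A))" .
  qed
  have "emeasure (dirac_sum n a l) A = ?\<nu> A"
  proof (rule emeasure_measure_of[OF dirac_sum_def])
    show "sets circle_borel \<subseteq> Pow (space circle_borel)"
      by (rule sets.space_closed)
  qed (use assms ca in \<open>auto simp: positive_def\<close>)
  then show ?thesis
    using assms by simp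
qed

definition poisson_integral :: "complex measure \<Rightarrow> complex \<Rightarrow> real" where
  "poisson_integral \<mu> z = (LINT \<zeta>|\<mu>. (1 - (norm z)\<^sup>2) / (norm (\<zeta> - z))\<^sup>2)"

text \<open>Normalized area measure on the disc is \<open>uniform_measure lborel disc\<close>.\<close>

definition dirichlet_integral :: "complex measure \<Rightarrow> (complex \<Rightarrow> complex) \<Rightarrow> ennreal" where
  "dirichlet_integral \<mu> f =
     (\<integral>\<^sup>+z\<in>disc. ennreal ((norm (deriv f z))\<^sup>2 * poisson_integral \<mu> z)
        \<partial>uniform_measure lborel disc)"

definition dirichlet_space :: "complex measure \<Rightarrow> (complex \<Rightarrow> complex) set" where
  "dirichlet_space \<mu> = {f. f holomorphic_on disc \<and> dirichlet_integral \<mu> f < \<infinity>}"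

text \<open>
  Only meaningful for \<open>f\<close> in \<open>dirichlet_space \<mu>\<close>, which for a nonzero finite \<open>\<mu>\<close> is contained
  in \<open>hardy_space\<close>.
\<close>

definition dirichlet_norm :: "complex measure \<Rightarrow> (complex \<Rightarrow> complex) \<Rightarrow> real" where
  "dirichlet_norm \<mu> f = sqrt ((hardy_norm f)\<^sup>2 + enn2real (dirichlet_integral \<mu> f))"

definition decomposition ::
    "nat \<Rightarrow> (nat \<Rightarrow> complex) \<Rightarrow> (complex \<Rightarrow> complex) \<Rightarrow> complex poly \<Rightarrow> (complex \<Rightarrow> complex) \<Rightarrow> bool" where
  "decomposition n l f p g \<longleftrightarrow> g \<in> hardy_space \<and> degree p \<le> n - 1 \<and>
     (\<forall>z\<in>disc. f z = poly p z + (\<Prod>j=1..n. z - l j) * g z)"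

end

theory Submission
  imports Defs
begin

text \<open>
  For a single point \<open>\<xi>\<close> of the circle put \<open>h(z) = f'(z) / (z - \<xi>)\<close>. Since \<open>\<bar>f'(z)\<bar>\<^sup>2 P(z)\<close>
  equals \<open>\<bar>h(z)\<bar>\<^sup>2 (1 - \<bar>z\<bar>\<^sup>2)\<close> for the Poisson kernel \<open>P\<close> at \<open>\<xi>\<close>, orthogonality of the monomials for
  rotation invariant measures turns the local Dirichlet integral at \<open>\<xi>\<close> into
  \<open>\<Sum>k. \<bar>h\<^sub>k\<bar>\<^sup>2 / ((k + 1) (k + 2))\<close>. If \<open>f = c + (z - \<xi>) g\<close> and \<open>g = (z - \<xi>) u\<close>, then
  \<open>h = 2 u + (z - \<xi>) u'\<close>, and the coefficients satisfy a telescoping identity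
  \<open>(\<Sum>k\<le>K. \<bar>g\<^sub>k\<bar>\<^sup>2) = (\<Sum>k<K. \<bar>h\<^sub>k\<bar>\<^sup>2 / ((k + 1) (k + 2))) + \<bar>u\<^sub>K\<bar>\<^sup>2 / (K + 1)\<close>. It bounds the local integral
  by \<open>\<parallel>g\<parallel>\<^sup>2\<close>; conversely, when the local integral \<open>D\<close> is finite, the recurrence for \<open>u\<close> has a solution
  with \<open>\<bar>u\<^sub>K\<bar>\<^sup>2 \<le> (K + 1) D\<close>, whence \<open>\<parallel>g\<parallel>\<^sup>2 \<le> 2 D\<close>.

  For several points, write \<open>f = c\<^sub>j + (z - \<lambda>\<^sub>j) g\<^sub>j\<close> at each of them and multiply by the partial fraction
  identity \<open>1 = (\<Sum>j. w\<^sub>j \<Prod>i\<noteq>j. (z - \<lambda>\<^sub>i))\<close>: then \<open>p\<close> is the Lagrange interpolant of the \<open>c\<^sub>j\<close> and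
  \<open>g = (\<Sum>j. w\<^sub>j g\<^sub>j)\<close>. Uniqueness holds because \<open>c / (z - \<xi>)\<close> has coefficients of constant modulus and so lies
  in the Hardy space only for \<open>c = 0\<close>.
\<close>

subsection \<open>Rotation invariance of planar Lebesgue measure\<close>

lemma borel_measurable_Complex [measurable (raw)]:
  assumes [measurable]: "f \<in> borel_measurable M" "g \<in> borel_measurable M"
  shows "(\<lambda>x. Complex (f x) (g x)) \<in> borel_measurable M"
  by (simp add: Complex_eq)

text \<open>Lebesgue measure is determined by its values on boxes, and a box in the plane is a
  product of two intervals. This makes Fubini available for integrals over
  \<open>complex\<close>.\<close>

lemma lborel_complex_eq_distr_prod:
  "lborel = distr (lborel \<Otimes>\<^sub>M lborel) borel (\<lambda>(x, y). Complex x y)"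
proof (rule lborel_eqI)
  have meas [measurable]: "(\<lambda>(x, y). Complex x y) \<in> lborel \<Otimes>\<^sub>M lborel \<rightarrow>\<^sub>M borel"
    by (simp add: case_prod_beta)
  fix l u :: complex
  assume "\<And>b. b \<in> Basis \<Longrightarrow> l \<bullet> b \<le> u \<bullet> b"
  from this[of 1] this[of \<i>] have le: "Re l \<le> Re u" "Im l \<le> Im u"
    by (auto simp: Basis_complex_def)
  have "emeasure (distr (lborel \<Otimes>\<^sub>M lborel) borel (\<lambda>(x, y). Complex x y)) (box l u) =
      emeasure (lborel \<Otimes>\<^sub>M lborel) ({Re l<..<Re u} \<times> {Im l<..<Im u})"
    by (subst emeasure_distr)
       (auto simp: in_box_complex_iff space_pair_measure intro!: arg_cong2[where f=emeasure])
  also have "\<dots> = ennreal (\<Prod>b\<in>Basis. (u - l) \<bullet> b)"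
    using le by (simp add: lborel.emeasure_pair_measure_Times Basis_complex_def ennreal_mult)
  finally show "emeasure (distr (lborel \<Otimes>\<^sub>M lborel) borel (\<lambda>(x, y). Complex x y)) (box l u) =
      ennreal (\<Prod>b\<in>Basis. (u - l) \<bullet> b)" .
qed simp

lemma nn_integral_lborel_complex:
  assumes [measurable]: "F \<in> borel_measurable borel"
  shows "(\<integral>\<^sup>+z. F z \<partial>lborel) = (\<integral>\<^sup>+x. \<integral>\<^sup>+y. F (Complex x y) \<partial>lborel \<partial>lborel)"
    and "(\<integral>\<^sup>+z. F z \<partial>lborel) = (\<integral>\<^sup>+y. \<integral>\<^sup>+x. F (Complex x y) \<partial>lborel \<partial>lborel)"
proof -
  have "(\<integral>\<^sup>+z. F z \<partial>lborel) = (\<integral>\<^sup>+p. F (Complex (fst p) (snd p)) \<partial>(lborel \<Otimes>\<^sub>M lborel))"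
    by (subst lborel_complex_eq_distr_prod, subst nn_integral_distr) (auto simp: case_prod_beta)
  then show "(\<integral>\<^sup>+z. F z \<partial>lborel) = (\<integral>\<^sup>+x. \<integral>\<^sup>+y. F (Complex x y) \<partial>lborel \<partial>lborel)"
    by (simp add: lborel.nn_integral_fst[symmetric])
  with lborel_pair.Fubini[of "\<lambda>p. F (Complex (fst p) (snd p))"]
  show "(\<integral>\<^sup>+z. F z \<partial>lborel) = (\<integral>\<^sup>+y. \<integral>\<^sup>+x. F (Complex x y) \<partial>lborel \<partial>lborel)"
    by simp
qed

text \<open>On each horizontal line the shear is a translation, by \<open>t * y\<close> at height
  \<open>y\<close>, so the inner integral over \<open>x\<close> does not change.\<close>

lemma lborel_distr_shear_Re:
  "distr lborel borel (\<lambda>z. z + complex_of_real (t * Im z)) = lborel"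
proof (rule measure_eqI)
  have meas [measurable]: "(\<lambda>z. z + complex_of_real (t * Im z)) \<in> borel_measurable borel"
    by (intro borel_measurable_continuous_onI continuous_intros)
  fix A assume "A \<in> sets (distr lborel borel (\<lambda>z. z + complex_of_real (t * Im z)))"
  then have A [measurable]: "A \<in> sets borel" by simp
  have "emeasure (distr lborel borel (\<lambda>z. z + complex_of_real (t * Im z))) A =
      (\<integral>\<^sup>+z. indicator A (z + complex_of_real (t * Im z)) \<partial>lborel)"
    by (subst nn_integral_indicator[symmetric], simp, subst nn_integral_distr) auto
  also have "\<dots> = (\<integral>\<^sup>+y. \<integral>\<^sup>+x. indicator A (Complex (t * y + x) y) \<partial>lborel \<partial>lborel)"
    by (subst nn_integral_lborel_complex(2)) (auto simp: complex_eq_iff intro!: nn_integral_cong arg_cong[where f="indicator A"])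
  also have "\<dots> = (\<integral>\<^sup>+y. \<integral>\<^sup>+x. indicator A (Complex x y) \<partial>lborel \<partial>lborel)"
  proof (rule nn_integral_cong)
    fix y
    have "(\<lambda>x. indicator A (Complex x y) :: ennreal) \<in> borel_measurable borel"
      by measurable
    then show "(\<integral>\<^sup>+x. indicator A (Complex (t * y + x) y) \<partial>lborel) =
        (\<integral>\<^sup>+x. indicator A (Complex x y) \<partial>lborel)"
      using nn_integral_real_affine[of "\<lambda>x. indicator A (Complex x y)" 1 "t * y"] by simp
  qed
  also have "\<dots> = emeasure lborel A"
    by (subst nn_integral_lborel_complex(2)[symmetric]) auto
  finally show "emeasure (distr lborel borel (\<lambda>z. z + complex_of_real (t * Im z))) A = emeasure lborel A" .
qed simp

text \<open>The same argument on vertical lines, with the other order of integration.\<close>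

lemma lborel_distr_shear_Im:
  "distr lborel borel (\<lambda>z. z + \<i> * complex_of_real (t * Re z)) = lborel"
proof (rule measure_eqI)
  have meas [measurable]: "(\<lambda>z. z + \<i> * complex_of_real (t * Re z)) \<in> borel_measurable borel"
    by (intro borel_measurable_continuous_onI continuous_intros)
  fix A assume "A \<in> sets (distr lborel borel (\<lambda>z. z + \<i> * complex_of_real (t * Re z)))"
  then have A [measurable]: "A \<in> sets borel" by simp
  have "emeasure (distr lborel borel (\<lambda>z. z + \<i> * complex_of_real (t * Re z))) A =
      (\<integral>\<^sup>+z. indicator A (z + \<i> * complex_of_real (t * Re z)) \<partial>lborel)"
    by (subst nn_integral_indicator[symmetric], simp, subst nn_integral_distr) auto
  also have "\<dots> = (\<integral>\<^sup>+x. \<integral>\<^sup>+y. indicator A (Complex x (t * x + y)) \<partial>lborel \<partial>lborel)"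
    by (subst nn_integral_lborel_complex(1)) (auto simp: complex_eq_iff intro!: nn_integral_cong arg_cong[where f="indicator A"])
  also have "\<dots> = (\<integral>\<^sup>+x. \<integral>\<^sup>+y. indicator A (Complex x y) \<partial>lborel \<partial>lborel)"
  proof (rule nn_integral_cong)
    fix x
    have "(\<lambda>y. indicator A (Complex x y) :: ennreal) \<in> borel_measurable borel"
      by measurable
    then show "(\<integral>\<^sup>+y. indicator A (Complex x (t * x + y)) \<partial>lborel) =
        (\<integral>\<^sup>+y. indicator A (Complex x y) \<partial>lborel)"
      using nn_integral_real_affine[of "\<lambda>y. indicator A (Complex x y)" 1 "t * x"] by simp
  qed
  also have "\<dots> = emeasure lborel A"
    by (subst nn_integral_lborel_complex(1)[symmetric]) auto
  finally show "emeasure (distr lborel borel (\<lambda>z. z + \<i> * complex_of_real (t * Re z))) A = emeasure lborel A" .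
qed simp

text \<open>
  A rotation by an angle \<open>\<theta> \<noteq> \<pi>\<close> is a product of three shears, with parameters
  \<open>- tan (\<theta> / 2)\<close>, \<open>sin \<theta>\<close> and again \<open>- tan (\<theta> / 2)\<close>.
\<close>

lemma lborel_distr_rotation:
  fixes \<omega> :: complex
  assumes "norm \<omega> = 1" "\<omega> \<noteq> -1"
  shows "distr lborel borel ((*) \<omega>) = lborel"
proof -
  define c s where "c = Re \<omega>" and "s = Im \<omega>"
  have cs: "c\<^sup>2 + s\<^sup>2 = 1"
    using assms(1) by (simp add: c_def s_def norm_complex_def)
  have c: "1 + c \<noteq> 0"
  proof
    assume "1 + c = 0"
    then have "c = -1" by simp
    with cs have "\<omega> = -1" by (auto simp: c_def s_def complex_eq_iff)
    with assms(2) show False by simp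
  qed
  \<comment> \<open>For \<open>\<omega> = cis \<theta>\<close> this is
    \<open>- tan (\<theta> / 2)\<close> by the half-angle formula; excluding \<open>-1\<close> keeps
    the denominator nonzero.\<close>
  define t where "t = - s / (1 + c)"
  define S1 S2 where "S1 = (\<lambda>z. z + complex_of_real (t * Im z))"
    and "S2 = (\<lambda>z. z + \<i> * complex_of_real (s * Re z))"
  have m [measurable]: "S1 \<in> borel_measurable borel" "S2 \<in> borel_measurable borel"
    unfolding S1_def S2_def by (intro borel_measurable_continuous_onI continuous_intros)+
  \<comment> \<open>The left sides are entries of the matrix of the composed shears: the diagonal
    must be \<open>cos \<theta>\<close> and the upper right entry
    \<open>- sin \<theta>\<close>.\<close>
  have ts: "1 + t * s = c" "2 * t + t\<^sup>2 * s = - s"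
  proof -
    have "s\<^sup>2 = (1 - c) * (1 + c)" using cs by (simp add: algebra_simps power2_eq_square)
    then have *: "t * s = - (1 - c)"
      using c by (simp add: t_def power2_eq_square field_simps)
    then show "1 + t * s = c" by simp
    have "2 * t + t\<^sup>2 * s = t * (2 + t * s)" by (simp add: power2_eq_square algebra_simps)
    also have "\<dots> = t * (1 + c)" using * by simp
    finally show "2 * t + t\<^sup>2 * s = - s" using c by (simp add: t_def)
  qed
  have eq: "(*) \<omega> = S1 \<circ> (S2 \<circ> S1)"
  proof
    fix z
    have "Re ((S1 \<circ> (S2 \<circ> S1)) z) = (1 + t * s) * Re z + (2 * t + t\<^sup>2 * s) * Im z"
      "Im ((S1 \<circ> (S2 \<circ> S1)) z) = s * Re z + (1 + t * s) * Im z"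
      by (auto simp: S1_def S2_def algebra_simps power2_eq_square)
    then show "\<omega> * z = (S1 \<circ> (S2 \<circ> S1)) z"
      unfolding ts by (auto simp: complex_eq_iff c_def s_def)
  qed
  have "distr lborel borel ((*) \<omega>) = distr (distr (distr lborel borel S1) borel S2) borel S1"
    unfolding eq by (simp add: distr_distr)
  also have "\<dots> = lborel"
    unfolding S1_def S2_def lborel_distr_shear_Re lborel_distr_shear_Im ..
  finally show ?thesis .
qed

subsection \<open>Parseval identity for rotation invariant measures\<close>

text \<open>The angle \<open>pi / (2 * (j - k))\<close> works. As \<open>j\<close> and
  \<open>k\<close> differ by at least 1, it is at most \<open>pi / 2\<close> in modulus, so its
  cosine is nonnegative and the rotation avoids \<open>-1\<close>, where the decomposition into
  shears breaks down.\<close>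

lemma exists_rotation_orthogonal:
  fixes j k :: nat
  assumes "j \<noteq> k"
  obtains \<omega> :: complex where "norm \<omega> = 1" "\<omega> \<noteq> -1" "\<omega> ^ j * cnj \<omega> ^ k = \<i>"
proof
  define d where "d = real j - real k"
  define \<theta> where "\<theta> = pi / 2 / d"
  have d: "\<bar>d\<bar> \<ge> 1" using assms unfolding d_def by linarith
  then have "\<bar>\<theta>\<bar> \<le> pi / 2"
    unfolding \<theta>_def abs_divide by (simp add: divide_le_eq mult_left_mono)
  then have "cos \<theta> \<ge> 0"
    by (intro cos_ge_zero) auto
  then show "cis \<theta> \<noteq> -1"
    by (auto simp: complex_eq_iff)
  show "norm (cis \<theta>) = 1" by simp
  have "cis \<theta> ^ j * cnj (cis \<theta>) ^ k = cis (d * \<theta>)"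
    by (simp only: cis_cnj Complex.DeMoivre cis_mult) (simp add: d_def algebra_simps)
  also have "d * \<theta> = pi / 2" using d by (auto simp: \<theta>_def)
  finally show "cis \<theta> ^ j * cnj (cis \<theta>) ^ k = \<i>" by simp
qed

text \<open>Substituting a suitable rotation multiplies the integrand by \<open>\<i>\<close>, while
  invariance of the measure preserves the integral; hence the integral equals \<open>\<i>\<close>
  times itself.\<close>

lemma integral_rotation_invariant_orthogonal:
  fixes \<nu> :: "complex measure"
  assumes sets [measurable_cong]: "sets \<nu> = sets borel"
    and rot: "\<And>\<omega>. norm \<omega> = 1 \<Longrightarrow> \<omega> \<noteq> -1 \<Longrightarrow> distr \<nu> borel ((*) \<omega>) = \<nu>"
    and "j \<noteq> k"
  shows "(LINT z|\<nu>. z ^ j * cnj z ^ k) = 0"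
proof -
  obtain \<omega> :: complex where \<omega>: "norm \<omega> = 1" "\<omega> \<noteq> -1" "\<omega> ^ j * cnj \<omega> ^ k = \<i>"
    using exists_rotation_orthogonal[OF \<open>j \<noteq> k\<close>] .
  let ?I = "LINT z|\<nu>. z ^ j * cnj z ^ k"
  have [measurable]: "(\<lambda>z. z ^ j * cnj z ^ k) \<in> borel_measurable borel"
    by (intro borel_measurable_continuous_onI continuous_intros)
  have [measurable]: "(*) \<omega> \<in> \<nu> \<rightarrow>\<^sub>M borel" by measurable
  have "?I = (LINT z|distr \<nu> borel ((*) \<omega>). z ^ j * cnj z ^ k)"
    using rot \<omega> by simp
  also have "\<dots> = (LINT z|\<nu>. (\<omega> * z) ^ j * cnj (\<omega> * z) ^ k)"
    by (subst integral_distr) auto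
  also have "\<dots> = (LINT z|\<nu>. (\<omega> ^ j * cnj \<omega> ^ k) * (z ^ j * cnj z ^ k))"
    by (intro Bochner_Integration.integral_cong) (auto simp: power_mult_distrib)
  also have "\<dots> = \<i> * ?I"
    unfolding \<omega>(3) by simp
  finally have "(1 - \<i>) * ?I = 0" by (simp add: algebra_simps)
  then show ?thesis by (auto simp: complex_eq_iff)
qed

text \<open>Expanding the square gives a double sum of monomials whose off-diagonal integrals vanish
  by orthogonality. All monomials are integrable, being bounded almost everywhere on a finite
  measure space.\<close>

lemma rotation_invariant_norm_poly_square:
  fixes \<nu> :: "complex measure" and c :: "nat \<Rightarrow> complex"
  assumes "finite_measure \<nu>"
    and sets [measurable_cong]: "sets \<nu> = sets borel"
    and rot: "\<And>\<omega>. norm \<omega> = 1 \<Longrightarrow> \<omega> \<noteq> -1 \<Longrightarrow> distr \<nu> borel ((*) \<omega>) = \<nu>"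
    and bd: "AE z in \<nu>. norm z \<le> 1"
  shows "(\<integral>\<^sup>+z. ennreal ((norm (\<Sum>k<N. c k * z ^ k))\<^sup>2) \<partial>\<nu>) =
    (\<Sum>k<N. ennreal ((norm (c k))\<^sup>2) * (\<integral>\<^sup>+z. ennreal (norm z ^ (2 * k)) \<partial>\<nu>))"
proof -
  interpret finite_measure \<nu> by fact
  have meas [measurable]: "(\<lambda>z. z ^ j * cnj z ^ k) \<in> borel_measurable \<nu>" for j k :: nat
    unfolding measurable_cong_sets[OF sets refl]
    by (intro borel_measurable_continuous_onI continuous_intros)
  have int: "integrable \<nu> (\<lambda>z. z ^ j * cnj z ^ k)" for j k :: nat
  proof (rule integrable_const_bound[where B = 1])
    show "AE z in \<nu>. norm (z ^ j * cnj z ^ k) \<le> 1"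
      using bd by eventually_elim (auto simp: norm_mult norm_power intro!: mult_le_one power_le_one)
  qed measurable
  have int': "integrable \<nu> (\<lambda>z. norm z ^ (2 * k))" for k
  proof (rule integrable_const_bound[where B = 1])
    show "AE z in \<nu>. norm (norm z ^ (2 * k)) \<le> 1"
      using bd by eventually_elim (auto simp: norm_power intro!: power_le_one)
  qed measurable
  have sq: "complex_of_real ((norm (\<Sum>k<N. c k * z ^ k))\<^sup>2) =
      (\<Sum>j<N. \<Sum>k<N. c j * cnj (c k) * (z ^ j * cnj z ^ k))" for z
    by (simp only: complex_norm_square cnj_sum sum_product) (simp add: mult_ac)
  have diag: "z ^ k * cnj z ^ k = complex_of_real (norm z ^ (2 * k))" for z k
    by (simp only: power_mult of_real_power[of "(norm z)\<^sup>2"] complex_norm_square power_mult_distrib)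
  have isq: "integrable \<nu> (\<lambda>z. complex_of_real ((norm (\<Sum>k<N. c k * z ^ k))\<^sup>2))"
    unfolding sq by (intro Bochner_Integration.integrable_sum integrable_mult_right int)
  then have isq': "integrable \<nu> (\<lambda>z. (norm (\<Sum>k<N. c k * z ^ k))\<^sup>2)"
    unfolding complex_of_real_integrable_eq .
  have "complex_of_real (LINT z|\<nu>. (norm (\<Sum>k<N. c k * z ^ k))\<^sup>2) =
      (LINT z|\<nu>. (\<Sum>j<N. \<Sum>k<N. c j * cnj (c k) * (z ^ j * cnj z ^ k)))"
    unfolding sq[symmetric] by (simp only: integral_complex_of_real)
  also have "\<dots> = (\<Sum>j<N. \<Sum>k<N. c j * cnj (c k) * (LINT z|\<nu>. z ^ j * cnj z ^ k))"
    by (simp add: Bochner_Integration.integral_sum Bochner_Integration.integrable_sum int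
        del: mult.assoc)
  also have "\<dots> = (\<Sum>j<N. \<Sum>k<N. if k = j then c j * cnj (c j) * (LINT z|\<nu>. z ^ j * cnj z ^ j) else 0)"
    by (intro sum.cong refl) (auto simp: integral_rotation_invariant_orthogonal[OF sets rot])
  also have "\<dots> = (\<Sum>j<N. c j * cnj (c j) * (LINT z|\<nu>. z ^ j * cnj z ^ j))"
    by simp
  also have "\<dots> = complex_of_real (\<Sum>j<N. (norm (c j))\<^sup>2 * (LINT z|\<nu>. norm z ^ (2 * j)))"
    unfolding diag integral_complex_of_real by (simp only: complex_norm_square of_real_sum of_real_mult)
  finally have eq: "(LINT z|\<nu>. (norm (\<Sum>k<N. c k * z ^ k))\<^sup>2) =
      (\<Sum>j<N. (norm (c j))\<^sup>2 * (LINT z|\<nu>. norm z ^ (2 * j)))"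
    by (simp only: of_real_eq_iff)
  have "(\<integral>\<^sup>+z. ennreal ((norm (\<Sum>k<N. c k * z ^ k))\<^sup>2) \<partial>\<nu>) =
      ennreal (\<Sum>j<N. (norm (c j))\<^sup>2 * (LINT z|\<nu>. norm z ^ (2 * j)))"
    using isq' by (subst nn_integral_eq_integral) (auto simp: eq)
  also have "\<dots> = (\<Sum>j<N. ennreal ((norm (c j))\<^sup>2) * ennreal (LINT z|\<nu>. norm z ^ (2 * j)))"
    by (simp add: ennreal_mult integral_nonneg flip: sum_ennreal)
  also have "\<dots> = (\<Sum>k<N. ennreal ((norm (c k))\<^sup>2) * (\<integral>\<^sup>+z. ennreal (norm z ^ (2 * k)) \<partial>\<nu>))"
    using int' by (subst nn_integral_eq_integral) auto
  finally show ?thesis .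
qed

text \<open>Dominated convergence in the polynomial case: the absolutely convergent series at radius
  \<open>R\<close> gives one constant bounding all partial sums almost everywhere, and constants are
  integrable for a finite measure.\<close>

lemma rotation_invariant_parseval:
  fixes \<nu> :: "complex measure" and c :: "nat \<Rightarrow> complex"
  assumes fin: "finite_measure \<nu>"
    and sets [measurable_cong]: "sets \<nu> = sets borel"
    and rot: "\<And>\<omega>. norm \<omega> = 1 \<Longrightarrow> \<omega> \<noteq> -1 \<Longrightarrow> distr \<nu> borel ((*) \<omega>) = \<nu>"
    and R: "0 \<le> R" "R \<le> 1" "summable (\<lambda>k. norm (c k) * R ^ k)"
    and bd: "AE z in \<nu>. norm z \<le> R"
    and h [measurable]: "h \<in> borel_measurable \<nu>" "AE z in \<nu>. (\<lambda>k. c k * z ^ k) sums h z"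
  shows "(\<integral>\<^sup>+z. ennreal ((norm (h z))\<^sup>2) \<partial>\<nu>) =
    (\<Sum>k. ennreal ((norm (c k))\<^sup>2) * (\<integral>\<^sup>+z. ennreal (norm z ^ (2 * k)) \<partial>\<nu>))"
proof -
  interpret finite_measure \<nu> by fact
  define B where "B = (\<Sum>k. norm (c k) * R ^ k)"
  have S_le: "norm (\<Sum>k<N. c k * z ^ k) \<le> B" if "norm z \<le> R" for z N
  proof -
    have "norm (\<Sum>k<N. c k * z ^ k) \<le> (\<Sum>k<N. norm (c k) * R ^ k)"
      using that by (intro sum_norm_le) (auto simp: norm_mult norm_power intro!: mult_left_mono power_mono)
    also have "\<dots> \<le> B"
      unfolding B_def using R(1,3) by (intro sum_le_suminf) auto
    finally show ?thesis .
  qed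
  have m [measurable]: "(\<lambda>z. \<Sum>k<N. c k * z ^ k) \<in> borel_measurable \<nu>" for N
    by measurable
  have "(\<lambda>N. \<integral>\<^sup>+z. ennreal ((norm (\<Sum>k<N. c k * z ^ k))\<^sup>2) \<partial>\<nu>)
      \<longlonglongrightarrow> (\<integral>\<^sup>+z. ennreal ((norm (h z))\<^sup>2) \<partial>\<nu>)"
  proof (rule nn_integral_dominated_convergence[where w = "\<lambda>_. ennreal (B\<^sup>2)"])
    show "AE z in \<nu>. ennreal ((norm (\<Sum>k<N. c k * z ^ k))\<^sup>2) \<le> ennreal (B\<^sup>2)" for N
      using bd by eventually_elim (auto intro!: ennreal_leI power_mono S_le)
    show "(\<integral>\<^sup>+z. ennreal (B\<^sup>2) \<partial>\<nu>) < \<infinity>"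
      by (simp add: ennreal_mult_less_top emeasure_eq_measure)
    show "AE z in \<nu>. (\<lambda>N. ennreal ((norm (\<Sum>k<N. c k * z ^ k))\<^sup>2)) \<longlonglongrightarrow> ennreal ((norm (h z))\<^sup>2)"
      using h(2) by eventually_elim (auto simp: sums_def intro!: tendsto_ennrealI tendsto_intros)
  qed measurable
  moreover have "AE z in \<nu>. norm z \<le> 1"
    using bd by eventually_elim (use R(2) in auto)
  ultimately have "(\<lambda>N. \<Sum>k<N. ennreal ((norm (c k))\<^sup>2) * (\<integral>\<^sup>+z. ennreal (norm z ^ (2 * k)) \<partial>\<nu>))
      \<longlonglongrightarrow> (\<integral>\<^sup>+z. ennreal ((norm (h z))\<^sup>2) \<partial>\<nu>)"
    by (subst (asm) rotation_invariant_norm_poly_square[OF fin sets rot])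
  then show ?thesis
    using summable_LIMSEQ[OF summableI] LIMSEQ_unique by blast
qed

section \<open>Radial integrals over the disc\<close>

lemma emeasure_lborel_ball_complex:
  fixes c :: complex
  shows "r \<ge> 0 \<Longrightarrow> emeasure lborel (ball c r) = ennreal (pi * r\<^sup>2)"
    "r \<ge> 0 \<Longrightarrow> emeasure lborel (cball c r) = ennreal (pi * r\<^sup>2)"
  by (simp_all add: emeasure_ball emeasure_cball unit_ball_vol_2)

lemma borel_measurable_indicator_disc [measurable]:
  "(indicator disc :: complex \<Rightarrow> ennreal) \<in> borel_measurable borel"
  by (intro borel_measurable_indicator) simp

text \<open>Polar coordinates in the variable \<open>(norm z)\<^sup>2\<close>: the area of a disc is
  linear in its squared radius, so the image measure has constant density. It suffices to compare
  rays \<open>{x<..}\<close>, whose preimages are the disc, an annulus or empty.\<close>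

lemma distr_disc_norm_square:
  "distr (density lborel (indicator disc)) borel (\<lambda>z::complex. (norm z)\<^sup>2) =
     density lborel (\<lambda>x. ennreal pi * indicator {0..1} x)"
proof (rule measure_eqI_lessThan)
  fix x :: real
  have [measurable]: "(\<lambda>z::complex. (norm z)\<^sup>2) -` {x<..} \<in> sets borel"
    by (rule measurable_sets_borel[of _ borel]) auto
  have eq1: "emeasure (distr (density lborel (indicator disc)) borel (\<lambda>z::complex. (norm z)\<^sup>2)) {x<..} =
      emeasure lborel {z\<in>disc. x < (norm z)\<^sup>2}"
    by (subst emeasure_distr, simp, simp, simp, subst emeasure_density)
       (auto simp: nn_integral_indicator[symmetric] simp del: nn_integral_indicator
         intro!: nn_integral_cong split: split_indicator)
  also have "emeasure lborel {z\<in>disc. x < (norm z)\<^sup>2} = ennreal pi * emeasure lborel ({0..1} \<inter> {x<..})"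
  proof -
    consider "x < 0" | "0 \<le> x" "x < 1" | "x \<ge> 1" by linarith
    then show ?thesis
    proof cases
      case 1
      then have "{z\<in>disc. x < (norm z)\<^sup>2} = disc" "{0..1} \<inter> {x<..} = {0..1}"
        by (auto intro: less_le_trans)
      then show ?thesis
        by (simp add: emeasure_lborel_ball_complex)
    next
      case 2
      have iff: "x < (norm z)\<^sup>2 \<longleftrightarrow> sqrt x < norm z" for z :: complex
        using 2 by (metis norm_ge_zero real_sqrt_abs real_sqrt_less_iff abs_of_nonneg)
      have "{z\<in>disc. x < (norm z)\<^sup>2} = (disc - cball 0 (sqrt x) :: complex set)"
        by (simp only: iff) auto
      moreover have "{0..1} \<inter> {x<..} = {x<..1}"
        using \<open>0 \<le> x\<close> by auto
      moreover have "cball 0 (sqrt x) \<subseteq> (disc :: complex set)"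
      proof
        fix z :: complex assume "z \<in> cball 0 (sqrt x)"
        moreover have "sqrt x < 1" using 2 by simp
        ultimately show "z \<in> disc" unfolding mem_cball mem_ball by linarith
      qed
      ultimately show ?thesis
        using 2 by (simp add: emeasure_Diff emeasure_lborel_ball_complex ennreal_minus
            right_diff_distrib flip: ennreal_mult)
    next
      case 3
      have "{z\<in>disc. x < (norm z)\<^sup>2} = {}"
      proof safe
        fix z :: complex assume "z \<in> disc" "x < (norm z)\<^sup>2"
        moreover from this have "(norm z)\<^sup>2 \<le> 1" by (simp add: power_le_one)
        ultimately show "z \<in> {}" using 3 by linarith
      qed
      moreover have "{0..1} \<inter> {x<..} = {}" using 3 by auto
      ultimately show ?thesis by (simp only: emeasure_empty mult_zero_right)
    qed
  qed
  also have "\<dots> = emeasure (density lborel (\<lambda>x. ennreal pi * indicator {0..1} x)) {x<..}"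
    by (subst emeasure_density)
       (auto simp: mult.assoc nn_integral_cmult indicator_inter_arith[symmetric])
  finally show *: "emeasure (distr (density lborel (indicator disc)) borel (\<lambda>z::complex. (norm z)\<^sup>2)) {x<..} =
    emeasure (density lborel (\<lambda>x. ennreal pi * indicator {0..1} x)) {x<..}" .
  have "emeasure lborel {z\<in>disc. x < (norm z)\<^sup>2} \<le> emeasure lborel (disc :: complex set)"
    by (intro emeasure_mono) auto
  then show "emeasure (distr (density lborel (indicator disc)) borel (\<lambda>z::complex. (norm z)\<^sup>2)) {x<..} < \<infinity>"
    unfolding eq1 by (rule le_less_trans) (simp add: emeasure_lborel_ball_complex)
qed simp_all

lemma nn_integral_disc_radial:
  assumes [measurable]: "F \<in> borel_measurable borel"
  shows "(\<integral>\<^sup>+z\<in>disc. F ((norm z)\<^sup>2) \<partial>lborel) = ennreal pi * (\<integral>\<^sup>+x\<in>{0..1}. F x \<partial>lborel)"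
proof -
  have "(\<integral>\<^sup>+z\<in>disc. F ((norm z)\<^sup>2) \<partial>lborel) =
      (\<integral>\<^sup>+x. F x \<partial>distr (density lborel (indicator disc)) borel (\<lambda>z::complex. (norm z)\<^sup>2))"
    by (subst nn_integral_distr, simp, simp, subst nn_integral_density) (auto simp: mult.commute)
  also have "\<dots> = ennreal pi * (\<integral>\<^sup>+x\<in>{0..1}. F x \<partial>lborel)"
    unfolding distr_disc_norm_square
    by (simp add: nn_integral_density nn_integral_cmult[symmetric] mult_ac)
  finally show ?thesis .
qed

text \<open>With \<open>x = (norm z)\<^sup>2\<close> this is \<open>pi\<close> times the integral of
  \<open>x ^ k * (1 - x)\<close> over the unit interval, which is
  \<open>1 / (k + 1) - 1 / (k + 2)\<close>. Here the weights of the local Dirichlet integral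
  originate.\<close>

lemma nn_integral_disc_weighted_monomial:
  "(\<integral>\<^sup>+z\<in>disc. ennreal (norm z ^ (2 * k) * (1 - (norm z)\<^sup>2)) \<partial>(lborel :: complex measure)) =
     ennreal (pi / ((real k + 1) * (real k + 2)))"
proof -
  have "(\<integral>\<^sup>+z\<in>disc. ennreal (norm z ^ (2 * k) * (1 - (norm z)\<^sup>2)) \<partial>(lborel :: complex measure)) =
      ennreal pi * (\<integral>\<^sup>+x\<in>{0..1}. ennreal (x ^ k * (1 - x)) \<partial>lborel)"
    using nn_integral_disc_radial[of "\<lambda>x. ennreal (x ^ k * (1 - x))"] by (simp add: power_mult)
  also have "(\<integral>\<^sup>+x\<in>{0..1}. ennreal (x ^ k * (1 - x)) \<partial>lborel) =
      ennreal ((1 ^ (k + 1) / (real k + 1) - 1 ^ (k + 2) / (real k + 2)) -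
        (0 ^ (k + 1) / (real k + 1) - 0 ^ (k + 2) / (real k + 2)))"
  proof (rule nn_integral_FTC_Icc)
    fix x :: real assume "x \<in> {0..1}"
    have "((\<lambda>x. x ^ (k + 1)) has_real_derivative (real k + 1) * x ^ k) (at x)"
      "((\<lambda>x. x ^ (k + 2)) has_real_derivative (real k + 2) * x ^ (k + 1)) (at x)"
      using DERIV_pow[of "k + 1" x UNIV] DERIV_pow[of "k + 2" x UNIV]
      by (simp_all add: add.commute)
    then have "((\<lambda>x. x ^ (k + 1) / (real k + 1) - x ^ (k + 2) / (real k + 2)) has_real_derivative
        (real k + 1) * x ^ k / (real k + 1) - (real k + 2) * x ^ (k + 1) / (real k + 2)) (at x)"
      by (intro DERIV_diff DERIV_cdivide)
    moreover have "(real k + 1) * x ^ k / (real k + 1) - (real k + 2) * x ^ (k + 1) / (real k + 2) = x ^ k * (1 - x)"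
    proof -
      have "real k + 1 \<noteq> 0" "real k + 2 \<noteq> 0" by linarith+
      then show ?thesis
        by (simp add: nonzero_mult_div_cancel_left right_diff_distrib del: of_nat_Suc)
    qed
    ultimately show "((\<lambda>x. x ^ (k + 1) / (real k + 1) - x ^ (k + 2) / (real k + 2)) has_real_derivative
        x ^ k * (1 - x)) (at x)"
      by (simp only:)
  qed (auto intro!: mult_nonneg_nonneg)
  also have "ennreal pi * \<dots> = ennreal (pi / ((real k + 1) * (real k + 2)))"
    by (simp add: ennreal_mult[symmetric] field_simps)
  finally show ?thesis .
qed

section \<open>Weighted area integrals of holomorphic functions\<close>

lemma holomorphic_disc_sums:
  assumes "f holomorphic_on disc" "z \<in> disc"
  shows "(\<lambda>k. fps_nth (fps_expansion f 0) k * z ^ k) sums f z"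
  using holomorphic_power_series[OF assms] by (simp add: fps_expansion_def)

lemma holomorphic_disc_abs_summable:
  assumes "f holomorphic_on disc" "0 \<le> r" "r < 1"
  shows "summable (\<lambda>k. norm (fps_nth (fps_expansion f 0) k) * r ^ k)"
proof -
  \<comment> \<open>A radius strictly between \<open>r\<close> and 1: convergence there forces
    absolute convergence at \<open>r\<close>.\<close>
  have "complex_of_real ((1 + r) / 2) \<in> disc"
    unfolding mem_ball dist_0_norm norm_of_real using assms by auto
  then have "summable (\<lambda>k. fps_nth (fps_expansion f 0) k * complex_of_real ((1 + r) / 2) ^ k)"
    using assms by (intro sums_summable[OF holomorphic_disc_sums])
  moreover have "norm (complex_of_real r) < norm (complex_of_real ((1 + r) / 2))"
    unfolding norm_of_real using assms by auto
  ultimately have "summable (\<lambda>k. norm (fps_nth (fps_expansion f 0) k * complex_of_real r ^ k))"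
    by (rule powser_insidea)
  then show ?thesis
    using assms by (simp add: norm_mult norm_power)
qed

text \<open>Values outside the disc are arbitrary, so measurability is obtained for the extension by
  zero.\<close>

lemma borel_measurable_holomorphic_disc:
  assumes "h holomorphic_on disc"
  shows "(\<lambda>z. indicator disc z *\<^sub>R h z) \<in> borel_measurable borel"
  using assms by (intro borel_measurable_continuous_on_indicator holomorphic_on_imp_continuous_on) auto

lemma disc_eq_Union_ball: "(disc :: complex set) = (\<Union>n. ball 0 (1 - 1 / real (Suc n)))"
proof safe
  fix z :: complex assume "z \<in> disc"
  then obtain n where "1 / real (Suc n) < 1 - norm z"
    using reals_Archimedean[of "1 - norm z"] by (auto simp: inverse_eq_divide)
  then show "z \<in> (\<Union>n. ball 0 (1 - 1 / real (Suc n)))"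
    by (auto intro!: exI[of _ n] simp del: of_nat_Suc)
next
  fix z :: complex and n :: nat assume "z \<in> ball 0 (1 - 1 / real (Suc n))"
  moreover have "1 / real (Suc n) > 0" by simp
  ultimately show "z \<in> disc" unfolding mem_ball by linarith
qed

text \<open>On a ball of radius below 1 the power series converges absolutely, and
  \<open>1 - (norm z)\<^sup>2\<close> restricted to the ball is the density of a finite rotation
  invariant measure, so Parseval applies. Letting the balls exhaust the disc gives the identity,
  infinite values included.\<close>

lemma nn_integral_disc_holomorphic_square:
  assumes hol: "h holomorphic_on disc"
  shows "(\<integral>\<^sup>+z\<in>disc. ennreal ((norm (h z))\<^sup>2 * (1 - (norm z)\<^sup>2)) \<partial>lborel) =
    (\<Sum>k. ennreal ((norm (fps_nth (fps_expansion h 0) k))\<^sup>2) * ennreal (pi / ((real k + 1) * (real k + 2))))"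
proof -
  define c where "c = fps_nth (fps_expansion h 0)"
  define h' where "h' = (\<lambda>z. indicator disc z *\<^sub>R h z)"
  have [measurable]: "h' \<in> borel_measurable borel"
    unfolding h'_def by (rule borel_measurable_holomorphic_disc[OF hol])
  define w :: "complex \<Rightarrow> ennreal" where "w = (\<lambda>z. ennreal (1 - (norm z)\<^sup>2))"
  have [measurable]: "w \<in> borel_measurable borel" unfolding w_def by measurable
  define B :: "nat \<Rightarrow> complex set" where "B n = ball 0 (1 - 1 / real (Suc n))" for n
  define F where "F = (\<lambda>z. w z * ennreal ((norm (h' z))\<^sup>2))"
  define G where "G = (\<lambda>z::complex. \<Sum>k. ennreal ((norm (c k))\<^sup>2) * (w z * ennreal (norm z ^ (2 * k))))"
  have [measurable]: "F \<in> borel_measurable borel" "G \<in> borel_measurable borel"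
    unfolding F_def G_def by measurable
  have [measurable]: "B n \<in> sets borel" for n unfolding B_def by simp
  have eqB: "(\<integral>\<^sup>+z\<in>B n. F z \<partial>lborel) = (\<integral>\<^sup>+z\<in>B n. G z \<partial>lborel)" for n
  proof -
    define u where "u = (\<lambda>z. w z * indicator (B n) z)"
    have [measurable]: "u \<in> borel_measurable borel" unfolding u_def by measurable
    define \<nu> where "\<nu> = density lborel u"
    define R where "R = 1 - 1 / real (Suc n)"
    have R: "0 \<le> R" "R < 1" by (auto simp: R_def)
    have B: "z \<in> B n \<longleftrightarrow> norm z < R" for z by (simp add: B_def R_def)
    have sets: "sets \<nu> = sets borel" by (simp add: \<nu>_def)
    have AE: "AE z in \<nu>. norm z < R"
      unfolding \<nu>_def by (subst AE_density) (auto simp: u_def B indicator_def intro!: AE_I2)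
    have "(\<integral>\<^sup>+z. ennreal ((norm (h' z))\<^sup>2) \<partial>\<nu>) =
      (\<Sum>k. ennreal ((norm (c k))\<^sup>2) * (\<integral>\<^sup>+z. ennreal (norm z ^ (2 * k)) \<partial>\<nu>))"
    proof (rule rotation_invariant_parseval)
      show "finite_measure \<nu>"
      proof
        have "emeasure \<nu> (space \<nu>) \<le> (\<integral>\<^sup>+z. indicator (ball 0 1 :: complex set) z \<partial>lborel)"
          unfolding \<nu>_def
        proof (subst emeasure_density, simp, simp, intro nn_integral_mono)
          fix z :: complex
          have "z \<in> B n \<Longrightarrow> z \<in> disc" unfolding B using R by simp
          then show "u z * indicator (space (density lborel u)) z \<le> indicator (ball 0 1) z"
            by (auto simp: u_def w_def split: split_indicator)
        qed
        also have "\<dots> < \<infinity>" by (simp add: emeasure_lborel_ball_complex)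
        finally show "emeasure \<nu> (space \<nu>) \<noteq> \<infinity>" by simp
      qed
      fix \<omega> :: complex assume \<omega>: "norm \<omega> = 1" "\<omega> \<noteq> -1"
      \<comment> \<open>The density depends on \<open>norm z\<close> only.\<close>
      have inv: "(\<lambda>z. u (\<omega> * z)) = u"
        using \<omega>(1) by (auto simp: u_def w_def B norm_mult indicator_def fun_eq_iff)
      have "\<nu> = density (distr lborel borel ((*) \<omega>)) u"
        unfolding \<nu>_def lborel_distr_rotation[OF \<omega>] ..
      also have "\<dots> = distr (density lborel (\<lambda>z. u (\<omega> * z))) borel ((*) \<omega>)"
        by (rule density_distr) auto
      also have "\<dots> = distr \<nu> borel ((*) \<omega>)"
        unfolding inv \<nu>_def ..
      finally show "distr \<nu> borel ((*) \<omega>) = \<nu>" ..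
    next
      show "AE z in \<nu>. norm z \<le> R" using AE by eventually_elim simp
      show "AE z in \<nu>. (\<lambda>k. c k * z ^ k) sums h' z"
        using AE
      proof eventually_elim
        case (elim z)
        then have "z \<in> disc" using R by simp
        then show ?case
          using holomorphic_disc_sums[OF hol] by (simp add: c_def h'_def)
      qed
      show "summable (\<lambda>k. norm (c k) * R ^ k)"
        unfolding c_def using R by (intro holomorphic_disc_abs_summable hol)
      show "h' \<in> borel_measurable \<nu>"
        unfolding measurable_cong_sets[OF sets refl] by simp
    qed (use R sets in auto)
    also have "(\<integral>\<^sup>+z. ennreal ((norm (h' z))\<^sup>2) \<partial>\<nu>) = (\<integral>\<^sup>+z\<in>B n. F z \<partial>lborel)"
      unfolding \<nu>_def by (subst nn_integral_density) (auto simp: u_def F_def mult_ac)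
    also have "(\<Sum>k. ennreal ((norm (c k))\<^sup>2) * (\<integral>\<^sup>+z. ennreal (norm z ^ (2 * k)) \<partial>\<nu>)) =
        (\<Sum>k. \<integral>\<^sup>+z. ennreal ((norm (c k))\<^sup>2) * (w z * ennreal (norm z ^ (2 * k))) * indicator (B n) z \<partial>lborel)"
      unfolding \<nu>_def
      by (subst nn_integral_density) (auto simp: u_def mult.assoc nn_integral_cmult mult_ac(2)[of "indicator _ _"])
    also have "\<dots> = (\<integral>\<^sup>+z\<in>B n. G z \<partial>lborel)"
      unfolding G_def by (subst nn_integral_suminf[symmetric]) (auto simp: ennreal_suminf_multc)
    finally show ?thesis .
  qed
  \<comment> \<open>Reading the integrals over the balls as measures with densities \<open>F\<close>
    and \<open>G\<close> lets continuity from below carry the equality to the union.\<close>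
  have "emeasure (density lborel F) (B n) = emeasure (density lborel G) (B n)" for n
    using eqB[of n] by (simp add: emeasure_density)
  moreover have "incseq B"
  proof (rule incseq_SucI)
    fix n
    show "B n \<le> B (Suc n)"
      unfolding B_def by (intro subset_ball diff_left_mono divide_left_mono) auto
  qed
  ultimately have "emeasure (density lborel F) (\<Union>n. B n) = emeasure (density lborel G) (\<Union>n. B n)"
    by (subst (1 2) SUP_emeasure_incseq[symmetric]) auto
  then have "(\<integral>\<^sup>+z\<in>disc. F z \<partial>lborel) = (\<integral>\<^sup>+z\<in>disc. G z \<partial>lborel)"
    unfolding B_def disc_eq_Union_ball[symmetric] by (simp add: emeasure_density)
  also have "\<dots> = (\<Sum>k. ennreal ((norm (c k))\<^sup>2) *
      (\<integral>\<^sup>+z\<in>disc. ennreal (norm z ^ (2 * k) * (1 - (norm z)\<^sup>2)) \<partial>(lborel :: complex measure)))"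
  proof -
    have "(\<integral>\<^sup>+z\<in>disc. G z \<partial>lborel) =
        (\<integral>\<^sup>+z. (\<Sum>k. ennreal ((norm (c k))\<^sup>2) * (ennreal (norm z ^ (2 * k) * (1 - (norm z)\<^sup>2)) * indicator disc z)) \<partial>lborel)"
    proof (rule nn_integral_cong)
      fix z :: complex
      have "w z * ennreal (norm z ^ (2 * k)) = ennreal (norm z ^ (2 * k) * (1 - (norm z)\<^sup>2))" for k
        unfolding w_def by (subst ennreal_mult') (auto simp: mult.commute)
      then show "G z * indicator disc z = (\<Sum>k. ennreal ((norm (c k))\<^sup>2) *
          (ennreal (norm z ^ (2 * k) * (1 - (norm z)\<^sup>2)) * indicator disc z))"
        by (simp only: G_def ennreal_suminf_multc[symmetric] mult.assoc)
    qed
    also have "\<dots> = (\<Sum>k. ennreal ((norm (c k))\<^sup>2) *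
      (\<integral>\<^sup>+z\<in>disc. ennreal (norm z ^ (2 * k) * (1 - (norm z)\<^sup>2)) \<partial>(lborel :: complex measure)))"
      by (subst nn_integral_suminf) (auto simp: nn_integral_cmult)
    finally show ?thesis .
  qed
  also have "(\<integral>\<^sup>+z\<in>disc. F z \<partial>lborel) =
      (\<integral>\<^sup>+z\<in>disc. ennreal ((norm (h z))\<^sup>2 * (1 - (norm z)\<^sup>2)) \<partial>lborel)"
    by (intro nn_integral_cong) (auto simp: F_def w_def h'_def ennreal_mult' mult_ac split: split_indicator)
  finally show ?thesis
    unfolding nn_integral_disc_weighted_monomial c_def .
qed

subsection \<open>Local Dirichlet integrals\<close>

text \<open>The Dirichlet integral for the unit point mass at \<open>\<xi>\<close>, with the Poisson
  kernel at \<open>\<xi>\<close> in place of the Poisson integral.\<close>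

definition local_dirichlet_integral :: "complex \<Rightarrow> (complex \<Rightarrow> complex) \<Rightarrow> ennreal" where
  "local_dirichlet_integral \<xi> f =
     (\<integral>\<^sup>+z\<in>disc. ennreal ((norm (deriv f z))\<^sup>2 * ((1 - (norm z)\<^sup>2) / (norm (\<xi> - z))\<^sup>2))
        \<partial>uniform_measure lborel disc)"

lemma holomorphic_deriv_disc: "f holomorphic_on disc \<Longrightarrow> deriv f holomorphic_on disc"
  by (rule holomorphic_deriv) auto

lemma disc_ne_sphere: "z \<in> disc \<Longrightarrow> \<xi> \<in> sphere 0 1 \<Longrightarrow> z \<noteq> (\<xi> :: complex)"
  by auto

lemma borel_measurable_local_dirichlet_integrand:
  assumes "f holomorphic_on disc"
  shows "(\<lambda>z. ennreal ((norm (deriv f z))\<^sup>2 * ((1 - (norm z)\<^sup>2) / (norm (\<xi> - z))\<^sup>2)) * indicator disc z)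
    \<in> borel_measurable borel"
proof -
  \<comment> \<open>Truncating the derivative to the disc changes nothing under the indicator and
    provides measurability.\<close>
  note [measurable] = borel_measurable_holomorphic_disc[OF holomorphic_deriv_disc[OF assms]]
  have "(\<lambda>z. ennreal ((norm (indicator disc z *\<^sub>R deriv f z))\<^sup>2 * ((1 - (norm z)\<^sup>2) / (norm (\<xi> - z))\<^sup>2)) * indicator disc z)
    \<in> borel_measurable borel"
    by measurable
  also have "(\<lambda>z. ennreal ((norm (indicator disc z *\<^sub>R deriv f z))\<^sup>2 * ((1 - (norm z)\<^sup>2) / (norm (\<xi> - z))\<^sup>2)) * indicator disc z) =
    (\<lambda>z. ennreal ((norm (deriv f z))\<^sup>2 * ((1 - (norm z)\<^sup>2) / (norm (\<xi> - z))\<^sup>2)) * indicator disc z)"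
    by (auto simp: fun_eq_iff split: split_indicator)
  finally show ?thesis .
qed

text \<open>The denominator of the Poisson kernel is absorbed into the derivative; since
  \<open>\<xi>\<close> lies outside the open disc, the quotient is holomorphic there. The factor
  \<open>pi\<close> cancels against the normalization of area.\<close>

lemma local_dirichlet_integral_eq_suminf:
  assumes f: "f holomorphic_on disc" and l: "\<xi> \<in> sphere 0 1"
  shows "local_dirichlet_integral \<xi> f =
    (\<Sum>k. ennreal ((norm (fps_nth (fps_expansion (\<lambda>z. deriv f z / (z - \<xi>)) 0) k))\<^sup>2 / ((real k + 1) * (real k + 2))))"
proof -
  define h where "h = (\<lambda>z. deriv f z / (z - \<xi>))"
  have hol: "h holomorphic_on disc"
    unfolding h_def using l by (intro holomorphic_intros holomorphic_deriv_disc f) auto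
  have pi: "emeasure lborel (disc :: complex set) = ennreal pi"
    by (simp add: emeasure_lborel_ball_complex)
  have "local_dirichlet_integral \<xi> f =
      (\<integral>\<^sup>+z\<in>disc. ennreal ((norm (deriv f z))\<^sup>2 * ((1 - (norm z)\<^sup>2) / (norm (\<xi> - z))\<^sup>2)) \<partial>lborel) / ennreal pi"
    unfolding local_dirichlet_integral_def
    using borel_measurable_local_dirichlet_integrand[OF f, of \<xi>]
    by (subst nn_integral_uniform_measure)
       (auto simp: pi mult.assoc indicator_inter_arith[symmetric])
  also have "(\<integral>\<^sup>+z\<in>disc. ennreal ((norm (deriv f z))\<^sup>2 * ((1 - (norm z)\<^sup>2) / (norm (\<xi> - z))\<^sup>2)) \<partial>lborel) =
      (\<integral>\<^sup>+z\<in>disc. ennreal ((norm (h z))\<^sup>2 * (1 - (norm z)\<^sup>2)) \<partial>lborel)"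
    by (intro nn_integral_cong)
       (auto simp: h_def norm_divide power_divide norm_minus_commute)
  also have "\<dots> = (\<Sum>k. ennreal ((norm (fps_nth (fps_expansion h 0) k))\<^sup>2 / ((real k + 1) * (real k + 2))) * ennreal pi)"
    unfolding nn_integral_disc_holomorphic_square[OF hol]
    by (simp add: ennreal_mult[symmetric])
  also have "\<dots> / ennreal pi = (\<Sum>k. ennreal ((norm (fps_nth (fps_expansion h 0) k))\<^sup>2 / ((real k + 1) * (real k + 2))))"
    by (subst ennreal_suminf_multc) (simp add: ennreal_mult_divide_eq)
  finally show ?thesis unfolding h_def .
qed

section \<open>Dirichlet integrals for finite sums of point masses\<close>

lemma dirac_sum_eq_distr:
  assumes "\<forall>j\<in>{1..n}. l j \<in> sphere 0 1"
  shows "dirac_sum n a l = distr (point_measure {1..n} (\<lambda>j. ennreal (a j))) circle_borel l"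
proof (rule measure_eqI)
  fix A assume "A \<in> sets (dirac_sum n a l)"
  then have A: "A \<in> sets circle_borel" by simp
  have meas: "l \<in> point_measure {1..n} (\<lambda>j. ennreal (a j)) \<rightarrow>\<^sub>M circle_borel"
    using assms by (auto simp: measurable_point_measure_eq1)
  have "emeasure (distr (point_measure {1..n} (\<lambda>j. ennreal (a j))) circle_borel l) A =
      (\<Sum>j\<in>l -` A \<inter> {1..n}. ennreal (a j))"
    using A meas by (subst emeasure_distr) (auto simp: space_point_measure emeasure_point_measure_finite)
  also have "\<dots> = (\<Sum>j=1..n. ennreal (a j) * indicator A (l j))"
    by (intro sum.mono_neutral_cong_left) (auto split: split_indicator_asm)
  finally show "emeasure (dirac_sum n a l) A = emeasure (distr (point_measure {1..n} (\<lambda>j. ennreal (a j))) circle_borel l) A"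
    using emeasure_dirac_sum[OF A] by simp
qed simp

lemma poisson_integral_dirac_sum:
  assumes "\<forall>j\<in>{1..n}. l j \<in> sphere 0 1" "\<forall>j\<in>{1..n}. a j > 0"
  shows "poisson_integral (dirac_sum n a l) z = (\<Sum>j=1..n. a j * ((1 - (norm z)\<^sup>2) / (norm (l j - z))\<^sup>2))"
proof -
  have meas: "l \<in> point_measure {1..n} (\<lambda>j. ennreal (a j)) \<rightarrow>\<^sub>M circle_borel"
    using assms by (auto simp: measurable_point_measure_eq1)
  have "(\<lambda>\<zeta>. (1 - (norm z)\<^sup>2) / (norm (\<zeta> - z))\<^sup>2) \<in> borel_measurable circle_borel"
    unfolding circle_borel_def by (rule measurable_restrict_space1) measurable
  \<comment> \<open>As an image of a point measure on the finite index set, \<open>dirac_sum\<close>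
    turns the integral into a finite sum by change of variables.\<close>
  then show ?thesis
    unfolding poisson_integral_def dirac_sum_eq_distr[OF assms(1)]
    using assms(2)
    by (subst integral_distr[OF meas], simp, subst lebesgue_integral_point_measure_finite)
       (auto intro: less_imp_le)
qed

lemma dirichlet_integral_dirac_sum:
  assumes "\<forall>j\<in>{1..n}. l j \<in> sphere 0 1" "\<forall>j\<in>{1..n}. a j > 0" "f holomorphic_on disc"
  shows "dirichlet_integral (dirac_sum n a l) f = (\<Sum>j=1..n. ennreal (a j) * local_dirichlet_integral (l j) f)"
proof -
  let ?F = "\<lambda>j z. ennreal ((norm (deriv f z))\<^sup>2 * ((1 - (norm z)\<^sup>2) / (norm (l j - z))\<^sup>2))"
  have "dirichlet_integral (dirac_sum n a l) f =
      (\<integral>\<^sup>+z. (\<Sum>j=1..n. ennreal (a j) * (?F j z * indicator disc z)) \<partial>uniform_measure lborel disc)"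
    unfolding dirichlet_integral_def
  proof (rule nn_integral_cong)
    fix z :: complex
    show "ennreal ((norm (deriv f z))\<^sup>2 * poisson_integral (dirac_sum n a l) z) * indicator disc z =
        (\<Sum>j=1..n. ennreal (a j) * (?F j z * indicator disc z))"
    proof (cases "z \<in> disc")
      case True
      then have "0 \<le> 1 - (norm z)\<^sup>2" by (simp add: power_le_one)
      then have "(\<Sum>j=1..n. ennreal (a j) * ?F j z) =
          (\<Sum>j=1..n. ennreal (a j * ((norm (deriv f z))\<^sup>2 * ((1 - (norm z)\<^sup>2) / (norm (l j - z))\<^sup>2))))"
        using assms(2) by (intro sum.cong refl ennreal_mult'[symmetric]) (simp add: less_imp_le)
      also have "\<dots> = ennreal (\<Sum>j=1..n. a j * ((norm (deriv f z))\<^sup>2 * ((1 - (norm z)\<^sup>2) / (norm (l j - z))\<^sup>2)))"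
        using \<open>0 \<le> 1 - (norm z)\<^sup>2\<close> assms(2) by (intro sum_ennreal) (simp add: less_imp_le)
      also have "\<dots> = ennreal ((norm (deriv f z))\<^sup>2 * poisson_integral (dirac_sum n a l) z)"
        unfolding poisson_integral_dirac_sum[OF assms(1,2)] sum_distrib_left
        by (intro arg_cong[where f = ennreal] sum.cong) (simp_all add: mult_ac)
      finally show ?thesis using True by simp
    qed simp
  qed
  also have "\<dots> = (\<Sum>j=1..n. ennreal (a j) * local_dirichlet_integral (l j) f)"
    unfolding local_dirichlet_integral_def
    using borel_measurable_local_dirichlet_integrand[OF assms(3)]
    by (subst nn_integral_sum) (auto simp: nn_integral_cmult uniform_measure_def)
  finally show ?thesis .
qed

section \<open>The telescoping identity\<close>

lemma norm_square_telescope: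
  fixes a b :: complex
  assumes "m > 0"
  shows "(norm (a - b))\<^sup>2 =
    (norm (complex_of_real (m + 1) * a - complex_of_real m * b))\<^sup>2 / (m * (m + 1)) + (norm b)\<^sup>2 / (m + 1) - (norm a)\<^sup>2 / m"
proof -
  \<comment> \<open>Squared moduli split into real and imaginary parts, so the real version of the
    identity suffices.\<close>
  have *: "(x - y)\<^sup>2 = ((m + 1) * x - m * y)\<^sup>2 / (m * (m + 1)) + y\<^sup>2 / (m + 1) - x\<^sup>2 / m" for x y :: real
  proof -
    have "p / (m * n) + q / n - r / m = (p + m * q - n * r) / (m * n)" if "n \<noteq> 0" for p q r n :: real
      using assms that by (simp add: add_divide_distrib diff_divide_distrib)
    then have "((m + 1) * x - m * y)\<^sup>2 / (m * (m + 1)) + y\<^sup>2 / (m + 1) - x\<^sup>2 / m =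
        (((m + 1) * x - m * y)\<^sup>2 + m * y\<^sup>2 - (m + 1) * x\<^sup>2) / (m * (m + 1))"
      using assms by simp
    also have "((m + 1) * x - m * y)\<^sup>2 + m * y\<^sup>2 - (m + 1) * x\<^sup>2 = (m * (m + 1)) * (x - y)\<^sup>2"
      by (simp add: algebra_simps power2_eq_square)
    also have "\<dots> / (m * (m + 1)) = (x - y)\<^sup>2"
      using assms by simp
    finally show ?thesis ..
  qed
  show ?thesis
    unfolding cmod_power2
    using *[of "Re a" "Re b"] *[of "Im a" "Im b"] by (simp add: add_divide_distrib)
qed

text \<open>The hypotheses are the coefficient relations of \<open>h = 2 u + (z - \<xi>) u'\<close>
  and \<open>g = (z - \<xi>) u\<close>. Each increment is the previous identity at
  \<open>m = K + 1\<close>, with \<open>U K\<close> and \<open>\<xi> * U (Suc K)\<close> for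
  \<open>a\<close> and \<open>b\<close>.\<close>

lemma sum_norm_square_telescope:
  fixes U H G :: "nat \<Rightarrow> complex"
  assumes l: "norm \<xi> = 1"
    and H: "\<And>k. H k = of_nat (k + 2) * U k - \<xi> * (of_nat (k + 1) * U (Suc k))"
    and G: "G 0 = - \<xi> * U 0" "\<And>k. G (Suc k) = U k - \<xi> * U (Suc k)"
  shows "(\<Sum>k\<le>K. (norm (G k))\<^sup>2) =
    (\<Sum>k<K. (norm (H k))\<^sup>2 / ((real k + 1) * (real k + 2))) + (norm (U K))\<^sup>2 / (real K + 1)"
proof (induction K)
  case 0
  then show ?case using l by (simp add: G norm_mult)
next
  case (Suc K)
  have "(norm (G (Suc K)))\<^sup>2 = (norm (H K))\<^sup>2 / ((real K + 1) * (real K + 2)) +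
      (norm (U (Suc K)))\<^sup>2 / (real K + 2) - (norm (U K))\<^sup>2 / (real K + 1)"
    unfolding G H using norm_square_telescope[of "real K + 1" "U K" "\<xi> * U (Suc K)"] l
    by (simp add: norm_mult add.assoc mult_ac add.commute)
  then show ?case
    using Suc.IH by (simp add: add_ac)
qed

section \<open>Power series expansions and Hardy space membership\<close>

lemma has_fps_expansion_disc: "f holomorphic_on disc \<Longrightarrow> f has_fps_expansion fps_expansion f 0"
  by (rule has_fps_expansion_fps_expansion[of disc]) auto

lemma eventually_disc: "(\<And>z. z \<in> disc \<Longrightarrow> P z) \<Longrightarrow> eventually P (nhds (0 :: complex))"
  by (rule eventually_mono[OF eventually_nhds_in_open[of disc]]) auto

lemma fps_expansion_cong_disc:
  assumes "\<And>z. z \<in> disc \<Longrightarrow> f z = g z"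
  shows "fps_expansion f 0 = fps_expansion g 0"
  by (intro fps_expansion_cong eventually_disc assms)

lemma fps_eq_if_eq_on_disc:
  assumes "f has_fps_expansion F" "g has_fps_expansion G" "\<And>z. z \<in> disc \<Longrightarrow> f z = g z"
  shows "F = G"
  using fps_expansion_cong_disc[OF assms(3)] fps_expansion_eqI[OF assms(1)] fps_expansion_eqI[OF assms(2)]
  by simp

lemma eq_on_disc_if_has_fps_expansion:
  assumes "f holomorphic_on disc" "g holomorphic_on disc" "f has_fps_expansion F" "g has_fps_expansion F"
    and "z \<in> disc"
  shows "f z = g z"
  using has_fps_expansion_imp_eval_fps_eq[OF assms(3) _ assms(1)]
    has_fps_expansion_imp_eval_fps_eq[OF assms(4) _ assms(2)] assms(5) by simp

lemma hardy_spaceI: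
  assumes "f holomorphic_on disc" "f has_fps_expansion F" "summable (\<lambda>k. (norm (fps_nth F k))\<^sup>2)"
  shows "f \<in> hardy_space"
  using assms fps_expansion_eqI[OF assms(2)] by (simp add: hardy_space_def)

lemma hardy_space_holomorphic: "f \<in> hardy_space \<Longrightarrow> f holomorphic_on disc"
  by (simp add: hardy_space_def)

lemma hardy_space_summable:
  "f \<in> hardy_space \<Longrightarrow> summable (\<lambda>k. (norm (fps_nth (fps_expansion f 0) k))\<^sup>2)"
  by (simp add: hardy_space_def)

lemma hardy_norm_power2:
  assumes "f \<in> hardy_space"
  shows "(hardy_norm f)\<^sup>2 = (\<Sum>k. (norm (fps_nth (fps_expansion f 0) k))\<^sup>2)"
  unfolding hardy_norm_def
  by (rule real_sqrt_pow2) (intro suminf_nonneg hardy_space_summable assms zero_le_power2)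

section \<open>Coefficient relations and estimates at one boundary point\<close>

lemma fps_square_factor_deriv:
  fixes U :: "complex fps"
  shows "fps_deriv (fps_const c + (fps_X - fps_const \<xi>)\<^sup>2 * U) =
    (fps_X - fps_const \<xi>) * (2 * U + (fps_X - fps_const \<xi>) * fps_deriv U)"
  by (simp add: power2_eq_square algebra_simps)

lemma fps_nth_linear_mult:
  fixes U :: "complex fps"
  shows "fps_nth ((fps_X - fps_const \<xi>) * U) 0 = - \<xi> * fps_nth U 0"
    and "fps_nth ((fps_X - fps_const \<xi>) * U) (Suc k) = fps_nth U k - \<xi> * fps_nth U (Suc k)"
  by (simp_all add: left_diff_distrib)

text \<open>The derivative term contributes \<open>k\<close> times coefficient \<open>k\<close> of
  \<open>U\<close>, which together with the 2 gives the factor \<open>k + 2\<close>.\<close>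

lemma fps_nth_derivative_quotient:
  fixes U :: "complex fps"
  shows "fps_nth (2 * U + (fps_X - fps_const \<xi>) * fps_deriv U) k =
    of_nat (k + 2) * fps_nth U k - \<xi> * (of_nat (k + 1) * fps_nth U (Suc k))"
proof -
  have "fps_nth (2 * U) k = 2 * fps_nth U k"
    by (simp only: mult_2 fps_add_nth)
  then show ?thesis
    by (cases k) (simp_all add: fps_nth_linear_mult algebra_simps)
qed

text \<open>The boundary term of the telescoping identity is nonnegative, so each partial sum for
  the local integral is at most a partial sum of the squared Hardy norm of \<open>g\<close>.\<close>

lemma local_dirichlet_integral_le:
  assumes l: "\<xi> \<in> sphere 0 1" and g: "g \<in> hardy_space" and f: "f holomorphic_on disc"
    and eq: "\<And>z. z \<in> disc \<Longrightarrow> f z = c + (z - \<xi>) * g z"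
  shows "local_dirichlet_integral \<xi> f \<le> ennreal ((hardy_norm g)\<^sup>2)"
proof -
  define h where "h = (\<lambda>z. deriv f z / (z - \<xi>))"
  define u where "u = (\<lambda>z. g z / (z - \<xi>))"
  have hol_g: "g holomorphic_on disc" by (rule hardy_space_holomorphic[OF g])
  have hol: "h holomorphic_on disc" "u holomorphic_on disc"
    unfolding h_def u_def using l by (auto intro!: holomorphic_intros holomorphic_deriv_disc f hol_g)
  define F H U G where "F = fps_expansion f 0" and "H = fps_expansion h 0"
    and "U = fps_expansion u 0" and "G = fps_expansion g 0"
  note exp = has_fps_expansion_disc[OF f, folded F_def] has_fps_expansion_disc[OF hol(1), folded H_def]
    has_fps_expansion_disc[OF hol(2), folded U_def] has_fps_expansion_disc[OF hol_g, folded G_def]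
  let ?L = "fps_X - fps_const \<xi>"
  have L0: "?L \<noteq> 0"
  proof
    assume "?L = 0"
    then have "fps_nth ?L 1 = fps_nth 0 1" by simp
    then show False by simp
  qed
  have G: "G = ?L * U"
  proof (rule fps_eq_if_eq_on_disc[OF exp(4)])
    show "(\<lambda>z. (z - \<xi>) * u z) has_fps_expansion ?L * U"
      by (intro fps_expansion_intros exp)
  qed (use disc_ne_sphere[OF _ l] in \<open>simp add: u_def\<close>)
  have F': "fps_deriv F = ?L * H"
  proof (rule fps_eq_if_eq_on_disc[OF has_fps_expansion_deriv[OF exp(1)]])
    show "(\<lambda>z. (z - \<xi>) * h z) has_fps_expansion ?L * H"
      by (intro fps_expansion_intros exp)
  qed (use disc_ne_sphere[OF _ l] in \<open>simp add: h_def\<close>)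
  have "F = fps_const c + ?L * G"
  proof (rule fps_eq_if_eq_on_disc[OF exp(1) _ eq])
    show "(\<lambda>z. c + (z - \<xi>) * g z) has_fps_expansion fps_const c + ?L * G"
      by (intro fps_expansion_intros exp)
  qed
  then have F: "F = fps_const c + ?L\<^sup>2 * U"
    by (simp add: G power2_eq_square mult.assoc)
  \<comment> \<open>Two expressions for the series of \<open>f'\<close>; the nonzero factor
    \<open>?L\<close> can be cancelled, as formal power series form an integral domain.\<close>
  have "?L * H = ?L * (2 * U + ?L * fps_deriv U)"
    unfolding F'[symmetric] F fps_square_factor_deriv ..
  then have H: "H = 2 * U + ?L * fps_deriv U"
    using L0 by simp
  have tele: "(\<Sum>k\<le>K. (norm (fps_nth G k))\<^sup>2) =
      (\<Sum>k<K. (norm (fps_nth H k))\<^sup>2 / ((real k + 1) * (real k + 2))) + (norm (fps_nth U K))\<^sup>2 / (real K + 1)" for K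
  proof (rule sum_norm_square_telescope)
    show "norm \<xi> = 1" using l by simp
  qed (simp_all only: G H fps_nth_linear_mult fps_nth_derivative_quotient)
  have "(\<Sum>k<K. (norm (fps_nth H k))\<^sup>2 / ((real k + 1) * (real k + 2))) \<le> (hardy_norm g)\<^sup>2" for K
  proof -
    have "(\<Sum>k<K. (norm (fps_nth H k))\<^sup>2 / ((real k + 1) * (real k + 2))) \<le> (\<Sum>k\<le>K. (norm (fps_nth G k))\<^sup>2)"
      unfolding tele by simp
    also have "\<dots> \<le> (hardy_norm g)\<^sup>2"
      unfolding hardy_norm_power2[OF g] G_def
      by (intro sum_le_suminf hardy_space_summable g) auto
    finally show ?thesis .
  qed
  then show ?thesis
    unfolding local_dirichlet_integral_eq_suminf[OF f l, folded h_def, folded H_def]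
    by (intro suminf_le_const summableI) (simp add: ennreal_leI sum_nonneg)
qed

text \<open>Recover \<open>u\<close> from \<open>h\<close> by solving the coefficient recurrence.
  The factor 2 arises because both the sum and the boundary term of the telescoping identity are at
  most the local integral.\<close>

lemma hardy_norm_power2_le_local_dirichlet_integral:
  assumes l: "\<xi> \<in> sphere 0 1" and f: "f holomorphic_on disc" and fin: "local_dirichlet_integral \<xi> f < \<infinity>"
  obtains c g where "g \<in> hardy_space" "\<And>z. z \<in> disc \<Longrightarrow> f z = c + (z - \<xi>) * g z"
    "(hardy_norm g)\<^sup>2 \<le> 2 * enn2real (local_dirichlet_integral \<xi> f)"
proof -
  have nl: "norm \<xi> = 1" using l by simp
  have cl: "cnj \<xi> ^ k * \<xi> ^ k = 1" for k
    using nl by (metis complex_norm_square mult.commute of_real_1 power_mult_distrib power_one)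
  define h where "h = (\<lambda>z. deriv f z / (z - \<xi>))"
  have hol_h: "h holomorphic_on disc"
    unfolding h_def using l by (auto intro!: holomorphic_intros holomorphic_deriv_disc f)
  define F H where "F = fps_expansion f 0" and "H = fps_expansion h 0"
  note expF = has_fps_expansion_disc[OF f, folded F_def]
    and expH = has_fps_expansion_disc[OF hol_h, folded H_def]
  let ?L = "fps_X - fps_const \<xi>"
  have F': "fps_deriv F = ?L * H"
  proof (rule fps_eq_if_eq_on_disc[OF has_fps_expansion_deriv[OF expF]])
    show "(\<lambda>z. (z - \<xi>) * h z) has_fps_expansion ?L * H"
      by (intro fps_expansion_intros expH)
  qed (use disc_ne_sphere[OF _ l] in \<open>simp add: h_def\<close>)
  define q where "q k = (real k + 1) * (real k + 2)" for k
  define s where "s k = (norm (fps_nth H k))\<^sup>2 / q k" for k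
  define D where "D = (\<Sum>k. s k)"
  have q_pos: "q k > 0" for k by (simp add: q_def)
  have s_nonneg: "s k \<ge> 0" for k using q_pos by (simp add: s_def less_imp_le)
  have local_eq: "local_dirichlet_integral \<xi> f = (\<Sum>k. ennreal (s k))"
    unfolding local_dirichlet_integral_eq_suminf[OF f l] s_def q_def H_def h_def ..
  have s_summable: "summable s"
    using fin unfolding local_eq by (intro summable_suminf_not_top s_nonneg) auto
  have local_D: "enn2real (local_dirichlet_integral \<xi> f) = D"
    unfolding local_eq D_def using s_nonneg s_summable
    by (subst suminf_ennreal2) (auto intro!: enn2real_ennreal suminf_nonneg)
  have D_nonneg: "D \<ge> 0" unfolding D_def using s_nonneg s_summable by (intro suminf_nonneg)
  \<comment> \<open>The exact tails of the reciprocal weights; they become one factor in the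
    Cauchy-Schwarz estimate of \<open>T\<close>.\<close>
  have q_tele: "(\<lambda>k. 1 / q (k + m)) sums (1 / (real m + 1))" for m
  proof -
    have "(\<lambda>k. 1 / (real (k + m) + 1) - 1 / (real (Suc k + m) + 1)) sums (1 / (real (0 + m) + 1) - 0)"
    proof (rule telescope_sums')
      show "(\<lambda>k. 1 / (real (k + m) + 1)) \<longlonglongrightarrow> 0"
        using LIMSEQ_ignore_initial_segment[OF LIMSEQ_inverse_real_of_nat, of m]
        by (simp add: inverse_eq_divide add_ac)
    qed
    moreover have "1 / (real (k + m) + 1) - 1 / (real (Suc k + m) + 1) = 1 / q (k + m)" for k
      by (simp add: q_def divide_simps)
    ultimately show ?thesis by simp
  qed
  have q_summable: "summable (\<lambda>k. 1 / q k)"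
    using q_tele[of 0] by (auto simp: sums_iff)

  txt \<open>
    The recurrence \<open>H\<^sub>k = (k + 2) U\<^sub>k - \<xi> (k + 1) U\<^sub>k\<^sub>+\<^sub>1\<close> becomes \<open>T\<^sub>k - T\<^sub>k\<^sub>+\<^sub>1 = a\<^sub>k\<close> under the
    substitution \<open>U\<^sub>k = (k + 1) \<xi>\<^sup>-\<^sup>k T\<^sub>k\<close>; the solution of order \<open>O(sqrt k)\<close> is the one with \<open>T\<^sub>k\<close>
    tending to 0, that is, \<open>T\<close> is the sequence of tails of \<open>\<Sum>k. a\<^sub>k\<close>.
  \<close>
  define a where "a k = \<xi> ^ k * (fps_nth H k / of_real (q k))" for k
  have norm_a: "norm (a k) = sqrt (s k) * sqrt (1 / q k)" for k
  proof -
    have "norm (a k) = norm (fps_nth H k) / q k"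
      using nl q_pos[of k] by (simp add: a_def norm_mult norm_power norm_divide)
    also have "\<dots> = sqrt (s k) * sqrt (1 / q k)"
      using q_pos[of k] by (simp add: s_def real_sqrt_divide)
    finally show ?thesis .
  qed
  \<comment> \<open>The arithmetic-geometric mean inequality dominates \<open>a\<close> by a
    summable sequence.\<close>
  have "norm (a k) \<le> s k + 1 / q k" for k
  proof -
    have "2 * (sqrt (s k) * sqrt (1 / q k)) \<le> (sqrt (s k))\<^sup>2 + (sqrt (1 / q k))\<^sup>2"
      using sum_squares_bound[of "sqrt (s k)" "sqrt (1 / q k)"] by (simp add: mult.assoc)
    also have "\<dots> = s k + 1 / q k"
      using s_nonneg[of k] q_pos[of k] by simp
    finally show ?thesis
      unfolding norm_a using s_nonneg[of k] q_pos[of k]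
      by (smt (verit) divide_nonneg_pos mult_nonneg_nonneg real_sqrt_ge_zero)
  qed
  then have a_summable: "summable a"
    by (intro summable_comparison_test'[OF summable_add[OF s_summable q_summable]])
  define T where "T m = (\<Sum>k. a (k + m))" for m
  have a_summable_shift: "summable (\<lambda>k. a (k + m))" for m
    using a_summable by (simp add: summable_iff_shift)
  have T_Suc: "T m = a m + T (Suc m)" for m
    using suminf_split_head[OF a_summable_shift[of m]] by (simp add: T_def)
  \<comment> \<open>Cauchy-Schwarz on finite pieces of the tail, with factors at most
    \<open>D\<close> and \<open>1 / (m + 1)\<close>, followed by the limit.\<close>
  have T_bound: "(norm (T m))\<^sup>2 \<le> D / (real m + 1)" for m
  proof -
    have "(norm (\<Sum>k<N. a (k + m)))\<^sup>2 \<le> D / (real m + 1)" for N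
    proof -
      have "(norm (\<Sum>k<N. a (k + m)))\<^sup>2 \<le> (\<Sum>k<N. norm (a (k + m)))\<^sup>2"
        by (intro power_mono norm_sum) simp
      also have "\<dots> \<le> (\<Sum>k<N. (sqrt (s (k + m)))\<^sup>2) * (\<Sum>k<N. (sqrt (1 / q (k + m)))\<^sup>2)"
        unfolding norm_a by (rule Cauchy_Schwarz_ineq_sum)
      also have "\<dots> = (\<Sum>k<N. s (k + m)) * (\<Sum>k<N. 1 / q (k + m))"
        using s_nonneg q_pos by (simp add: less_imp_le)
      also have "\<dots> \<le> D * (1 / (real m + 1))"
      proof (rule mult_mono)
        have "(\<Sum>k<N. s (k + m)) = (\<Sum>k\<in>{m..<N + m}. s k)"
          by (rule sum.reindex_bij_witness[of _ "\<lambda>k. k - m" "\<lambda>k. k + m"]) auto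
        also have "\<dots> \<le> D"
          unfolding D_def using s_summable s_nonneg by (intro sum_le_suminf) auto
        finally show "(\<Sum>k<N. s (k + m)) \<le> D" .
        show "(\<Sum>k<N. 1 / q (k + m)) \<le> 1 / (real m + 1)"
          using q_tele[of m] q_pos by (subst sums_unique[OF q_tele]) (intro sum_le_suminf, auto simp: sums_iff less_imp_le)
        show "0 \<le> (\<Sum>k<N. 1 / q (k + m))"
          using q_pos by (intro sum_nonneg) (simp add: less_imp_le)
      qed (rule D_nonneg)
      finally show ?thesis by simp
    qed
    moreover have "(\<lambda>N. (norm (\<Sum>k<N. a (k + m)))\<^sup>2) \<longlonglongrightarrow> (norm (T m))\<^sup>2"
      unfolding T_def by (intro tendsto_intros summable_LIMSEQ a_summable_shift)
    ultimately show ?thesis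
      by (intro LIMSEQ_le_const2) auto
  qed

  \<comment> \<open>On the circle \<open>cnj \<xi>\<close> is the inverse of \<open>\<xi>\<close>.
    The coefficients of \<open>V\<close> are bounded, so \<open>V\<close> converges on the whole
    disc, and the remaining factor \<open>k + 1\<close> of \<open>U\<close> comes from
    differentiating \<open>z * V(z)\<close>.\<close>
  define V where "V = Abs_fps (\<lambda>k. cnj \<xi> ^ k * T k)"
  have norm_V: "norm (fps_nth V k) \<le> sqrt D" for k
  proof -
    have "(norm (T k))\<^sup>2 \<le> D"
    proof -
      have "D / (real k + 1) \<le> D / 1"
        using D_nonneg by (intro divide_left_mono) auto
      then show ?thesis using T_bound[of k] by simp
    qed
    then have "norm (T k) \<le> sqrt D"
      by (rule real_le_rsqrt)
    then show ?thesis
      using nl by (simp add: V_def norm_mult norm_power)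
  qed
  have V_radius: "fps_conv_radius V \<ge> 1"
    unfolding fps_conv_radius_def
  proof (rule conv_radius_geI_ex')
    fix r :: real assume r: "0 < r" "ereal r < 1"
    show "summable (\<lambda>k. fps_nth V k * complex_of_real r ^ k)"
    proof (rule summable_comparison_test')
      show "summable (\<lambda>k. sqrt D * r ^ k)"
        using r by (intro summable_mult summable_geometric) (auto simp: one_ereal_def)
      show "norm (fps_nth V k * complex_of_real r ^ k) \<le> sqrt D * r ^ k" for k
        using r norm_V[of k] by (simp add: norm_mult norm_power mult_right_mono)
    qed
  qed
  have V_hol: "eval_fps V holomorphic_on disc"
  proof (rule holomorphic_on_eval_fps, rule subsetI)
    fix z :: complex assume "z \<in> disc"
    then have "ereal (norm z) < 1" by simp
    also note V_radius
    finally show "z \<in> eball 0 (fps_conv_radius V)" by simp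
  qed
  have expV: "eval_fps V has_fps_expansion V"
    by (rule eval_fps_has_fps_expansion, rule less_le_trans[OF _ V_radius]) simp
  define u where "u = deriv (\<lambda>z. z * eval_fps V z)"
  define U where "U = fps_deriv (fps_X * V)"
  have u_hol: "u holomorphic_on disc"
    unfolding u_def by (intro holomorphic_deriv_disc holomorphic_intros V_hol)
  have expU: "u has_fps_expansion U"
    unfolding u_def U_def by (intro fps_expansion_intros expV)
  have U_nth: "fps_nth U k = of_nat (k + 1) * (cnj \<xi> ^ k * T k)" for k
    by (simp add: U_def V_def distrib_right)
  \<comment> \<open>This is the boundary term of the telescoping identity: the square of the factor
    \<open>k + 1\<close> loses one power to the denominator, and the decay of \<open>T\<close>
    absorbs the other.\<close>
  have norm_U: "(norm (fps_nth U k))\<^sup>2 / (real k + 1) \<le> D" for k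
  proof -
    have "norm (fps_nth U k) = (real k + 1) * norm (T k)"
      unfolding U_nth norm_mult norm_power norm_of_nat complex_mod_cnj nl by simp
    moreover have "(x * y)\<^sup>2 / x = x * y\<^sup>2" if "x \<noteq> 0" for x y :: real
      using that by (simp add: power2_eq_square)
    ultimately have "(norm (fps_nth U k))\<^sup>2 / (real k + 1) = (real k + 1) * (norm (T k))\<^sup>2"
      by simp
    also have "\<dots> \<le> D"
      using T_bound[of k] by (simp add: field_simps)
    finally show ?thesis .
  qed
  have H_nth: "fps_nth H k = of_nat (k + 2) * fps_nth U k - \<xi> * (of_nat (k + 1) * fps_nth U (Suc k))" for k
  proof -
    have qk: "complex_of_real (q k) = of_nat (k + 1) * of_nat (k + 2)"
      by (simp add: q_def add.commute)
    have "of_nat (k + 2) * fps_nth U k - \<xi> * (of_nat (k + 1) * fps_nth U (Suc k)) =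
        of_real (q k) * cnj \<xi> ^ k * (T k - (cnj \<xi> ^ 1 * \<xi> ^ 1) * T (Suc k))"
      unfolding U_nth qk by (simp add: algebra_simps)
    also have "\<dots> = of_real (q k) * cnj \<xi> ^ k * a k"
      unfolding cl using T_Suc[of k] by simp
    also have "\<dots> = (cnj \<xi> ^ k * \<xi> ^ k) * fps_nth H k"
      using q_pos[of k] by (simp add: a_def)
    finally show ?thesis unfolding cl by simp
  qed
  define g where "g = (\<lambda>z. (z - \<xi>) * u z)"
  define G where "G = ?L * U"
  have g_hol: "g holomorphic_on disc"
    unfolding g_def by (intro holomorphic_intros u_hol)
  have expG: "g has_fps_expansion G"
    unfolding g_def G_def by (intro fps_expansion_intros expU)
  have partial: "(\<Sum>k\<le>K. (norm (fps_nth G k))\<^sup>2) \<le> 2 * D" for K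
  proof -
    have "(\<Sum>k\<le>K. (norm (fps_nth G k))\<^sup>2) = (\<Sum>k<K. (norm (fps_nth H k))\<^sup>2 / ((real k + 1) * (real k + 2))) +
        (norm (fps_nth U K))\<^sup>2 / (real K + 1)"
      by (rule sum_norm_square_telescope[OF nl H_nth]) (simp_all only: G_def fps_nth_linear_mult)
    also have "(\<Sum>k<K. (norm (fps_nth H k))\<^sup>2 / ((real k + 1) * (real k + 2))) \<le> D"
      unfolding D_def q_def[symmetric] s_def[symmetric]
      using s_summable s_nonneg by (intro sum_le_suminf) auto
    finally show ?thesis using norm_U[of K] by simp
  qed
  have G_summable: "summable (\<lambda>k. (norm (fps_nth G k))\<^sup>2)"
    by (rule bounded_imp_summable[OF _ partial]) simp
  have g: "g \<in> hardy_space"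
    by (rule hardy_spaceI[OF g_hol expG G_summable])
  have norm_g: "(hardy_norm g)\<^sup>2 \<le> 2 * D"
  proof -
    have "(\<Sum>k. (norm (fps_nth G k))\<^sup>2) \<le> 2 * D"
    proof (rule suminf_le_const[OF G_summable])
      show "(\<Sum>k<N. (norm (fps_nth G k))\<^sup>2) \<le> 2 * D" for N
        by (rule order_trans[OF sum_mono2 partial[of N]]) auto
    qed
    then show ?thesis
      using hardy_norm_power2[OF g] fps_expansion_eqI[OF expG] by simp
  qed
  have "H = 2 * U + ?L * fps_deriv U"
    by (rule fps_ext) (simp only: H_nth fps_nth_derivative_quotient)
  \<comment> \<open>The recurrence makes the derivatives agree, so \<open>F\<close> and
    \<open>?L\<^sup>2 * U\<close> differ by a constant, the required \<open>c\<close>.\<close>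
  then have "fps_deriv F = fps_deriv (fps_const 0 + ?L\<^sup>2 * U)"
    unfolding F' fps_square_factor_deriv by simp
  then obtain c where "F = fps_const c + ?L\<^sup>2 * U"
    unfolding fps_deriv_eq_iff_ex by auto
  then have F_eq: "F = fps_const c + ?L * G"
    by (simp add: G_def power2_eq_square mult.assoc)
  have "f z = c + (z - \<xi>) * g z" if "z \<in> disc" for z
  proof (rule eq_on_disc_if_has_fps_expansion[OF f _ expF _ that])
    show "(\<lambda>z. c + (z - \<xi>) * g z) holomorphic_on disc"
      by (intro holomorphic_intros g_hol)
    show "(\<lambda>z. c + (z - \<xi>) * g z) has_fps_expansion F"
      unfolding F_eq by (intro fps_expansion_intros expG)
  qed
  then show ?thesis
    using that[of g c] g norm_g local_D by simp
qed

subsection \<open>Linear structure of the Hardy space\<close>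

lemma hardy_norm_cong:
  assumes "\<And>z. z \<in> disc \<Longrightarrow> f z = g z"
  shows "hardy_norm f = hardy_norm g"
  unfolding hardy_norm_def using fps_expansion_cong_disc[of f g] assms by simp

text \<open>Cauchy-Schwarz over the index set, applied to each Taylor coefficient and then summed
  over all coefficients.\<close>

lemma hardy_space_sum:
  fixes w :: "'i \<Rightarrow> complex"
  assumes "finite I" and g: "\<And>i. i \<in> I \<Longrightarrow> g i \<in> hardy_space"
  shows "(\<lambda>z. \<Sum>i\<in>I. w i * g i z) \<in> hardy_space"
    and "(hardy_norm (\<lambda>z. \<Sum>i\<in>I. w i * g i z))\<^sup>2 \<le> (\<Sum>i\<in>I. (norm (w i))\<^sup>2) * (\<Sum>i\<in>I. (hardy_norm (g i))\<^sup>2)"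
proof -
  define G where "G i = fps_expansion (g i) 0" for i
  define S where "S = (\<Sum>i\<in>I. fps_const (w i) * G i)"
  let ?g = "\<lambda>z. \<Sum>i\<in>I. w i * g i z"
  let ?W = "\<Sum>i\<in>I. (norm (w i))\<^sup>2"
  have hol: "?g holomorphic_on disc"
    by (intro holomorphic_intros hardy_space_holomorphic g)
  have exp: "?g has_fps_expansion S"
    unfolding S_def G_def
    by (intro fps_expansion_intros has_fps_expansion_disc hardy_space_holomorphic g)
  have le: "(norm (fps_nth S k))\<^sup>2 \<le> ?W * (\<Sum>i\<in>I. (norm (fps_nth (G i) k))\<^sup>2)" for k
  proof -
    have "norm (fps_nth S k) \<le> (\<Sum>i\<in>I. norm (w i) * norm (fps_nth (G i) k))"
      unfolding S_def fps_sum_nth by (rule sum_norm_le) (simp add: norm_mult)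
    then have "(norm (fps_nth S k))\<^sup>2 \<le> (\<Sum>i\<in>I. norm (w i) * norm (fps_nth (G i) k))\<^sup>2"
      by (rule power_mono) simp
    also have "\<dots> \<le> ?W * (\<Sum>i\<in>I. (norm (fps_nth (G i) k))\<^sup>2)"
      by (rule Cauchy_Schwarz_ineq_sum)
    finally show ?thesis .
  qed
  have sumG: "summable (\<lambda>k. (norm (fps_nth (G i) k))\<^sup>2)" if "i \<in> I" for i
    unfolding G_def by (intro hardy_space_summable g that)
  have sum_bound: "summable (\<lambda>k. ?W * (\<Sum>i\<in>I. (norm (fps_nth (G i) k))\<^sup>2))"
    by (intro summable_mult summable_sum sumG)
  have sumS: "summable (\<lambda>k. (norm (fps_nth S k))\<^sup>2)"
    by (rule summable_comparison_test'[OF sum_bound]) (use le in simp)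
  show mem: "?g \<in> hardy_space"
    by (rule hardy_spaceI[OF hol exp sumS])
  have "(hardy_norm ?g)\<^sup>2 = (\<Sum>k. (norm (fps_nth S k))\<^sup>2)"
    using hardy_norm_power2[OF mem] fps_expansion_eqI[OF exp] by simp
  also have "\<dots> \<le> (\<Sum>k. ?W * (\<Sum>i\<in>I. (norm (fps_nth (G i) k))\<^sup>2))"
    by (intro suminf_le le sumS sum_bound)
  also have "\<dots> = ?W * (\<Sum>i\<in>I. \<Sum>k. (norm (fps_nth (G i) k))\<^sup>2)"
    by (subst suminf_mult) (auto intro!: summable_sum sumG simp: suminf_sum[OF sumG])
  also have "\<dots> = ?W * (\<Sum>i\<in>I. (hardy_norm (g i))\<^sup>2)"
    using hardy_norm_power2[OF g] by (simp add: G_def)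
  finally show "(hardy_norm ?g)\<^sup>2 \<le> ?W * (\<Sum>i\<in>I. (hardy_norm (g i))\<^sup>2)" .
qed

lemma hardy_space_linear:
  assumes "f \<in> hardy_space" "g \<in> hardy_space"
  shows "(\<lambda>z. a * f z + b * g z) \<in> hardy_space"
  using hardy_space_sum(1)[of "{True, False}" "\<lambda>i. if i then f else g" "\<lambda>i. if i then a else b"] assms
  by simp

lemma hardy_space_const: "(\<lambda>z. c) \<in> hardy_space"
proof (rule hardy_spaceI)
  show "summable (\<lambda>k. (norm (fps_nth (fps_const c) k))\<^sup>2)"
    by (rule summable_finite[of "{0}"]) auto
qed auto

lemma hardy_space_shift:
  assumes "f \<in> hardy_space"
  shows "(\<lambda>z. z * f z) \<in> hardy_space"
proof (rule hardy_spaceI)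
  show "(\<lambda>z. z * f z) holomorphic_on disc"
    by (intro holomorphic_intros hardy_space_holomorphic assms)
  show "(\<lambda>z. z * f z) has_fps_expansion fps_X * fps_expansion f 0"
    by (intro fps_expansion_intros has_fps_expansion_disc hardy_space_holomorphic assms)
  have "summable (\<lambda>k. (norm (fps_nth (fps_X * fps_expansion f 0) (Suc k)))\<^sup>2)"
    using hardy_space_summable[OF assms] by simp
  then show "summable (\<lambda>k. (norm (fps_nth (fps_X * fps_expansion f 0) k))\<^sup>2)"
    by (subst (asm) summable_Suc_iff)
qed

lemma hardy_space_poly_mult:
  assumes "f \<in> hardy_space"
  shows "(\<lambda>z. poly p z * f z) \<in> hardy_space"
proof (induction p)
  case 0
  then show ?case using hardy_space_const[of 0] by simp
next
  case (pCons a p)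
  have "(\<lambda>z. a * f z + 1 * (z * (poly p z * f z))) \<in> hardy_space"
    by (intro hardy_space_linear hardy_space_shift assms pCons.IH)
  then show ?case by (simp add: algebra_simps)
qed

lemma hardy_space_poly: "poly p \<in> hardy_space"
  using hardy_space_poly_mult[OF hardy_space_const[of 1]] by simp

text \<open>Comparing coefficients, each coefficient of \<open>k\<close> is \<open>\<xi>\<close>
  times the next one, so all have modulus \<open>norm c\<close>; a square summable sequence of
  constant modulus vanishes.\<close>

lemma hardy_space_no_boundary_pole:
  assumes l: "\<xi> \<in> sphere 0 1" and k: "k \<in> hardy_space"
    and eq: "\<And>z. z \<in> disc \<Longrightarrow> c = (z - \<xi>) * k z"
  shows "c = 0"
proof -
  define K where "K = fps_expansion k 0"
  have K: "fps_const c = (fps_X - fps_const \<xi>) * K"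
  proof (rule fps_eq_if_eq_on_disc[OF has_fps_expansion_const _ eq])
    show "(\<lambda>z. (z - \<xi>) * k z) has_fps_expansion (fps_X - fps_const \<xi>) * K"
      unfolding K_def by (intro fps_expansion_intros has_fps_expansion_disc hardy_space_holomorphic k)
  qed
  have "norm (fps_nth K i) = norm c" for i
  proof (induction i)
    case 0
    have "c = - \<xi> * fps_nth K 0"
      using arg_cong[OF K, of "\<lambda>F. fps_nth F 0"] fps_nth_linear_mult(1)[of \<xi> K] by simp
    then show ?case using l by (simp add: norm_mult)
  next
    case (Suc i)
    have "0 = fps_nth K i - \<xi> * fps_nth K (Suc i)"
      using arg_cong[OF K, of "\<lambda>F. fps_nth F (Suc i)"] fps_nth_linear_mult(2)[of \<xi> K i] by simp
    then have "norm (fps_nth K i) = norm (\<xi> * fps_nth K (Suc i))" by simp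
    then show ?case using l Suc.IH by (simp add: norm_mult)
  qed
  then have "summable (\<lambda>i::nat. (norm c)\<^sup>2)"
    using hardy_space_summable[OF k] by (simp add: K_def)
  then show ?thesis by (simp add: summable_const_iff)
qed

section \<open>Polynomials with prescribed roots and partial fractions\<close>

definition root_poly :: "complex set \<Rightarrow> complex poly" where
  "root_poly A = (\<Prod>x\<in>A. [:- x, 1:])"

lemma poly_root_poly: "poly (root_poly A) z = (\<Prod>x\<in>A. z - x)"
  by (simp add: root_poly_def poly_prod)

lemma degree_root_poly: "finite A \<Longrightarrow> degree (root_poly A) = card A"
  unfolding root_poly_def by (subst degree_prod_eq_sum_degree) auto

lemma poly_eq_if_agree_on_large_set:
  fixes p q :: "complex poly"
  assumes "degree p < card A" "degree q < card A" "\<And>x. x \<in> A \<Longrightarrow> poly p x = poly q x"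
  shows "p = q"
proof (rule ccontr)
  assume "p \<noteq> q"
  then have "p - q \<noteq> 0" by simp
  then have "card {x. poly (p - q) x = 0} \<le> degree (p - q)" "finite {x. poly (p - q) x = 0}"
    by (rule card_poly_roots_bound, rule poly_roots_finite)
  moreover have "A \<subseteq> {x. poly (p - q) x = 0}" using assms(3) by auto
  ultimately have "card A \<le> degree (p - q)"
    by (meson card_mono order_trans)
  with degree_diff_less[OF assms(1,2)] show False by simp
qed

text \<open>This is Lagrange interpolation of the constant 1: at a node all summands but one vanish,
  the weight normalizes that one to 1, and both sides have degree below
  \<open>card A\<close>.\<close>

lemma partial_fractions_one:
  fixes A :: "complex set"
  assumes "finite A" "A \<noteq> {}"
  shows "(\<Sum>x\<in>A. smult (inverse (\<Prod>y\<in>A - {x}. x - y)) (root_poly (A - {x}))) = 1"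
proof (rule poly_eq_if_agree_on_large_set[where A = A])
  have card: "card A > 0" using assms by (simp add: card_gt_0_iff)
  then show "degree (1 :: complex poly) < card A" by simp
  have "degree (\<Sum>x\<in>A. smult (inverse (\<Prod>y\<in>A - {x}. x - y)) (root_poly (A - {x}))) \<le> card A - 1"
    by (intro degree_sum_le assms(1) order_trans[OF degree_smult_le]) (use assms in \<open>simp add: degree_root_poly\<close>)
  then show "degree (\<Sum>x\<in>A. smult (inverse (\<Prod>y\<in>A - {x}. x - y)) (root_poly (A - {x}))) < card A"
    using card by linarith
  fix a assume a: "a \<in> A"
  have "poly (\<Sum>x\<in>A. smult (inverse (\<Prod>y\<in>A - {x}. x - y)) (root_poly (A - {x}))) a =
      (\<Sum>x\<in>A. inverse (\<Prod>y\<in>A - {x}. x - y) * (\<Prod>y\<in>A - {x}. a - y))"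
    by (simp add: poly_sum poly_root_poly)
  also have "\<dots> = (\<Sum>x\<in>A. if x = a then 1 else 0)"
  proof (intro sum.cong refl)
    fix x assume "x \<in> A"
    show "inverse (\<Prod>y\<in>A - {x}. x - y) * (\<Prod>y\<in>A - {x}. a - y) = (if x = a then 1 else 0)"
    proof (cases "x = a")
      case True
      have "(\<Prod>y\<in>A - {a}. a - y) \<noteq> 0" using assms by (subst prod_zero_iff) auto
      then show ?thesis using True by simp
    next
      case False
      then have "(\<Prod>y\<in>A - {x}. a - y) = 0" using a assms by (intro prod_zero) auto
      then show ?thesis using False by simp
    qed
  qed
  also have "\<dots> = poly 1 a" using a assms by simp
  finally show "poly (\<Sum>x\<in>A. smult (inverse (\<Prod>y\<in>A - {x}. x - y)) (root_poly (A - {x}))) a = poly 1 a" .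
qed

subsection \<open>Decompositions\<close>

lemma prod_eq_poly_root_poly:
  assumes "inj_on l {1..n::nat}"
  shows "(\<Prod>j=1..n. z - l j) = poly (root_poly (l ` {1..n})) z"
  unfolding poly_root_poly by (subst prod.reindex[OF assms]) simp

lemma poly_root_poly_nonzero:
  assumes "A \<subseteq> sphere 0 1" "finite A" "z \<in> disc"
  shows "poly (root_poly A) z \<noteq> 0"
  unfolding poly_root_poly using assms by (subst prod_zero_iff) auto

lemma poly_root_poly_remove:
  assumes "finite A" "\<xi> \<in> A"
  shows "poly (root_poly A) z = (z - \<xi>) * poly (root_poly (A - {\<xi>})) z"
  unfolding poly_root_poly using assms by (rule prod.remove)

lemma poly_eq_const_plus_linear_mult:
  fixes p :: "'a :: comm_ring_1 poly"
  obtains e where "\<And>z. poly p z = poly p \<xi> + (z - \<xi>) * poly e z"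
proof
  show "poly p z = poly p \<xi> + (z - \<xi>) * poly (synthetic_div p \<xi>) z" for z
    using arg_cong[OF synthetic_div_correct'[of \<xi> p], of "\<lambda>p. poly p z"]
    by (simp add: algebra_simps)
qed

text \<open>At a node \<open>x\<close> the difference \<open>p - q\<close> is \<open>z - x\<close>
  times a Hardy function. Splitting off its value at \<open>x\<close> leaves a constant of the same
  form, which must be 0. So \<open>p - q\<close> has \<open>n\<close> roots and degree below
  \<open>n\<close>; dividing by the product, which has no zeros in the disc, gives equality of
  \<open>g\<close> and \<open>h\<close>.\<close>

lemma decomposition_unique:
  assumes n: "n \<ge> 1" and l: "l ` {1..n} \<subseteq> sphere 0 1" and inj: "inj_on l {1..n}"
    and dec: "decomposition n l f p g" "decomposition n l f q h"
  shows "p = q" and "\<And>z. z \<in> disc \<Longrightarrow> g z = h z"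
proof -
  define A where "A = l ` {1..n}"
  have A: "finite A" "card A = n" "A \<subseteq> sphere 0 1"
    using inj l by (auto simp: A_def card_image)
  note prod_eq = prod_eq_poly_root_poly[OF inj, folded A_def]
  \<comment> \<open>Because \<open>n\<close> is positive, degree at most \<open>n - 1\<close>
    becomes the strict bound by \<open>card A\<close>.\<close>
  have g: "g \<in> hardy_space" "h \<in> hardy_space"
    and deg: "degree p < card A" "degree q < card A"
    and eq: "\<And>z. z \<in> disc \<Longrightarrow> poly p z + poly (root_poly A) z * g z = poly q z + poly (root_poly A) z * h z"
    using dec n A(2) unfolding decomposition_def prod_eq by force+
  show pq: "p = q"
  proof (rule poly_eq_if_agree_on_large_set[OF deg])
    fix x assume x: "x \<in> A"
    obtain e where e: "\<And>z. poly (p - q) z = poly (p - q) x + (z - x) * poly e z"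
      using poly_eq_const_plus_linear_mult[of "p - q" x] by blast
    \<comment> \<open>The quotient of the constant \<open>poly (p - q) x\<close> by
      \<open>z - x\<close>, expressed through both formulas for \<open>p - q\<close> and written as
      linear combinations.\<close>
    define k where "k = (\<lambda>z. 1 * (poly (root_poly (A - {x})) z * (1 * h z + (-1) * g z)) + (-1) * poly e z)"
    have "poly (p - q) x = 0"
    proof (rule hardy_space_no_boundary_pole)
      show "x \<in> sphere 0 1" using x A(3) by auto
      show "k \<in> hardy_space"
        unfolding k_def by (intro hardy_space_linear hardy_space_poly_mult hardy_space_poly g)
      fix z :: complex assume "z \<in> disc"
      then have "poly (p - q) z = (z - x) * poly (root_poly (A - {x})) z * (h z - g z)"
        using eq[of z] unfolding poly_root_poly_remove[OF A(1) x, symmetric] by (simp add: algebra_simps)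
      then show "poly (p - q) x = (z - x) * k z"
        unfolding e[of z] by (simp add: k_def algebra_simps)
    qed
    then show "poly p x = poly q x" by simp
  qed
  fix z :: complex assume z: "z \<in> disc"
  show "g z = h z"
    using eq[OF z] poly_root_poly_nonzero[OF A(3,1) z] pq by simp
qed

text \<open>Both \<open>p\<close> minus its value at \<open>l j\<close> and the product contain the
  factor \<open>z - l j\<close>, so the one-point estimate applies with the Hardy function
  \<open>k\<close>.\<close>

lemma local_dirichlet_integral_decomposition_finite:
  assumes l: "l ` {1..n} \<subseteq> sphere 0 1" and inj: "inj_on l {1..n}"
    and f: "f holomorphic_on disc" and dec: "decomposition n l f p g" and j: "j \<in> {1..n}"
  shows "local_dirichlet_integral (l j) f < \<infinity>"
proof -
  define A where "A = l ` {1..n}"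
  have A: "finite A" "l j \<in> A" using j by (auto simp: A_def)
  obtain e where e: "\<And>z. poly p z = poly p (l j) + (z - l j) * poly e z"
    using poly_eq_const_plus_linear_mult[of p "l j"] by blast
  define k where "k = (\<lambda>z. 1 * poly e z + 1 * (poly (root_poly (A - {l j})) z * g z))"
  have "local_dirichlet_integral (l j) f \<le> ennreal ((hardy_norm k)\<^sup>2)"
  proof (rule local_dirichlet_integral_le[OF _ _ f])
    show "l j \<in> sphere 0 1" using l j by blast
    show "k \<in> hardy_space"
      unfolding k_def using dec unfolding decomposition_def
      by (intro hardy_space_linear hardy_space_poly_mult hardy_space_poly) auto
    fix z :: complex assume "z \<in> disc"
    then have "f z = poly p z + (z - l j) * poly (root_poly (A - {l j})) z * g z"
      using dec unfolding decomposition_def prod_eq_poly_root_poly[OF inj, folded A_def]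
        poly_root_poly_remove[OF A] by blast
    then show "f z = poly p (l j) + (z - l j) * k z"
      unfolding e[of z] by (simp add: k_def algebra_simps)
  qed
  also have "\<dots> < \<infinity>" by simp
  finally show ?thesis .
qed

text \<open>The bound combines Cauchy-Schwarz for the weighted sum of the one-point quotients with
  the one-point estimates; its first factor depends only on the nodes.\<close>

lemma decomposition_exists:
  fixes l :: "nat \<Rightarrow> complex"
  assumes n: "n \<ge> 1" and l: "l ` {1..n} \<subseteq> sphere 0 1" and inj: "inj_on l {1..n}"
    and f: "f holomorphic_on disc" and fin: "\<And>j. j \<in> {1..n} \<Longrightarrow> local_dirichlet_integral (l j) f < \<infinity>"
  obtains g p where "decomposition n l f p g"
    "(hardy_norm g)\<^sup>2 \<le> (\<Sum>x\<in>l ` {1..n}. (norm (inverse (\<Prod>y\<in>l ` {1..n} - {x}. x - y)))\<^sup>2) *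
      (\<Sum>x\<in>l ` {1..n}. 2 * enn2real (local_dirichlet_integral x f))"
proof -
  define A where "A = l ` {1..n}"
  have A: "finite A" "A \<noteq> {}" "card A = n"
    using inj n by (auto simp: A_def card_image)
  have "\<exists>c g. g \<in> hardy_space \<and> (\<forall>z\<in>disc. f z = c + (z - x) * g z) \<and>
      (hardy_norm g)\<^sup>2 \<le> 2 * enn2real (local_dirichlet_integral x f)" if x: "x \<in> A" for x
  proof -
    have "x \<in> sphere 0 1" "local_dirichlet_integral x f < \<infinity>"
      using x l fin by (auto simp: A_def)
    from hardy_norm_power2_le_local_dirichlet_integral[OF this(1) f this(2)] show ?thesis
      by metis
  qed
  then obtain c g where cg: "\<And>x. x \<in> A \<Longrightarrow> g x \<in> hardy_space"
    "\<And>x z. x \<in> A \<Longrightarrow> z \<in> disc \<Longrightarrow> f z = c x + (z - x) * g x z"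
    "\<And>x. x \<in> A \<Longrightarrow> (hardy_norm (g x))\<^sup>2 \<le> 2 * enn2real (local_dirichlet_integral x f)"
    by metis
  define w where "w x = inverse (\<Prod>y\<in>A - {x}. x - y)" for x
  define p where "p = (\<Sum>x\<in>A. smult (c x) (smult (w x) (root_poly (A - {x}))))"
  define G where "G = (\<lambda>z. \<Sum>x\<in>A. w x * g x z)"
  have "degree p \<le> n - 1"
    unfolding p_def
    by (intro degree_sum_le A order_trans[OF degree_smult_le]) (use A in \<open>simp add: degree_root_poly\<close>)
  moreover have "G \<in> hardy_space"
    unfolding G_def by (intro hardy_space_sum(1) A cg)
  moreover have "f z = poly p z + (\<Prod>j=1..n. z - l j) * G z" if z: "z \<in> disc" for z
  proof -
    have "f z = (\<Sum>x\<in>A. w x * poly (root_poly (A - {x})) z) * f z"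
      using arg_cong[OF partial_fractions_one[OF A(1,2)], of "\<lambda>p. poly p z"]
      by (simp add: poly_sum w_def)
    also have "\<dots> = (\<Sum>x\<in>A. w x * poly (root_poly (A - {x})) z * (c x + (z - x) * g x z))"
      unfolding sum_distrib_right using cg(2)[OF _ z] by (intro sum.cong refl) simp
    \<comment> \<open>The constants collect into \<open>p\<close>, while each factor
      \<open>z - x\<close> completes the product over the other nodes to the full product.\<close>
    also have "\<dots> = (\<Sum>x\<in>A. c x * (w x * poly (root_poly (A - {x})) z) + poly (root_poly A) z * (w x * g x z))"
      using A(1) by (intro sum.cong refl) (simp add: poly_root_poly_remove algebra_simps)
    also have "\<dots> = poly p z + poly (root_poly A) z * G z"
      by (simp add: p_def G_def poly_sum sum.distrib sum_distrib_left mult.assoc)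
    finally show ?thesis
      unfolding prod_eq_poly_root_poly[OF inj, folded A_def] .
  qed
  ultimately have "decomposition n l f p G"
    by (simp add: decomposition_def)
  moreover have "(hardy_norm G)\<^sup>2 \<le> (\<Sum>x\<in>A. (norm (w x))\<^sup>2) * (\<Sum>x\<in>A. (hardy_norm (g x))\<^sup>2)"
    unfolding G_def by (intro hardy_space_sum(2) A cg)
  moreover have "\<dots> \<le> (\<Sum>x\<in>A. (norm (w x))\<^sup>2) * (\<Sum>x\<in>A. 2 * enn2real (local_dirichlet_integral x f))"
    by (intro mult_left_mono sum_mono cg sum_nonneg) auto
  ultimately show ?thesis
    using that unfolding A_def w_def by (meson order_trans)
qed

section \<open>Membership, uniqueness and norm control for finitely many point masses\<close>

theorem theorem3p1:
  fixes n :: nat and l :: "nat \<Rightarrow> complex" and a :: "nat \<Rightarrow> real" and \<mu> :: "complex measure"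
  assumes "n \<ge> 1"
    and "\<forall>j\<in>{1..n}. l j \<in> sphere 0 1"
    and "inj_on l {1..n}"
    and "\<forall>j\<in>{1..n}. a j > 0"
    and "\<mu> = dirac_sum n a l"
  shows "(\<forall>f. f holomorphic_on disc \<longrightarrow>
            (f \<in> dirichlet_space \<mu> \<longleftrightarrow> (\<exists>g p. decomposition n l f p g)))
       \<and> (\<forall>f g p h q. decomposition n l f p g \<and> decomposition n l f q h \<longrightarrow>
            p = q \<and> (\<forall>z\<in>disc. g z = h z))
       \<and> (\<exists>C>0. \<forall>f\<in>dirichlet_space \<mu>. \<forall>g p. decomposition n l f p g \<longrightarrow>
            hardy_norm g \<le> C * dirichlet_norm \<mu> f)"
proof -
  have l: "l ` {1..n} \<subseteq> sphere 0 1" using assms(2) by blast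
  note inj = assms(3)
  note dirichlet = dirichlet_integral_dirac_sum[OF assms(2,4), folded assms(5)]
  \<comment> \<open>The weights are positive and finite, so a finite weighted sum is finite exactly
    when every local integral is.\<close>
  have space_iff: "f \<in> dirichlet_space \<mu> \<longleftrightarrow> (\<forall>j\<in>{1..n}. local_dirichlet_integral (l j) f < \<infinity>)"
    if f: "f holomorphic_on disc" for f
  proof -
    have "f \<in> dirichlet_space \<mu> \<longleftrightarrow> (\<Sum>j=1..n. ennreal (a j) * local_dirichlet_integral (l j) f) < top"
      using f by (simp add: dirichlet_space_def dirichlet)
    also have "\<dots> \<longleftrightarrow> (\<forall>j\<in>{1..n}. local_dirichlet_integral (l j) f < top)"
    proof -
      have "ennreal (a j) * x < top \<longleftrightarrow> x < top" if "j \<in> {1..n}" for j x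
        using assms(4) that by (force simp: ennreal_mult_less_top ennreal_eq_0_iff)
      then show ?thesis
        by (simp add: ennreal_sum_less_top)
    qed
    finally show ?thesis by simp
  qed
  \<comment> \<open>\<open>W\<close> is the Cauchy-Schwarz factor of the partial fraction weights;
    \<open>S\<close> converts the unweighted sum of local integrals, with its factor 2, into the
    Dirichlet integral for the measure.\<close>
  define W where "W = (\<Sum>x\<in>l ` {1..n}. (norm (inverse (\<Prod>y\<in>l ` {1..n} - {x}. x - y)))\<^sup>2)"
  define S where "S = (\<Sum>j=1..n. 2 / a j)"
  have W: "W \<ge> 0" unfolding W_def by (intro sum_nonneg) simp
  have S: "S \<ge> 0" unfolding S_def using assms(4) by (intro sum_nonneg) (simp add: less_imp_le)
  have exists: "\<exists>g p. decomposition n l f p g \<and> (hardy_norm g)\<^sup>2 \<le> W * (S * enn2real (dirichlet_integral \<mu> f))"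
    if f: "f \<in> dirichlet_space \<mu>" for f
  proof -
    have hol: "f holomorphic_on disc" using f by (simp add: dirichlet_space_def)
    have fin: "local_dirichlet_integral (l j) f < \<infinity>" if "j \<in> {1..n}" for j
      using f space_iff[OF hol] that by blast
    define d where "d j = enn2real (local_dirichlet_integral (l j) f)" for j
    have d: "local_dirichlet_integral (l j) f = ennreal (d j)" if "j \<in> {1..n}" for j
      using fin[OF that] by (simp add: d_def)
    have d_nonneg: "d j \<ge> 0" for j by (simp add: d_def)
    have "dirichlet_integral \<mu> f = (\<Sum>j=1..n. ennreal (a j * d j))"
      unfolding dirichlet[OF hol] using assms(4) d d_nonneg
      by (intro sum.cong refl) (simp add: ennreal_mult less_imp_le)
    also have "\<dots> = ennreal (\<Sum>j=1..n. a j * d j)"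
      using assms(4) d_nonneg by (intro sum_ennreal) (simp add: less_imp_le)
    moreover have "0 \<le> (\<Sum>j=1..n. a j * d j)"
      using assms(4) d_nonneg by (intro sum_nonneg) (simp add: less_imp_le)
    ultimately have D: "enn2real (dirichlet_integral \<mu> f) = (\<Sum>j=1..n. a j * d j)"
      by simp
    have "(\<Sum>x\<in>l ` {1..n}. 2 * enn2real (local_dirichlet_integral x f)) = (\<Sum>j=1..n. 2 * d j)"
      unfolding d_def by (subst sum.reindex[OF inj]) simp
    also have "\<dots> = (\<Sum>j=1..n. 2 / a j * (a j * d j))"
    proof (intro sum.cong refl)
      fix j assume "j \<in> {1..n}"
      then have "a j \<noteq> 0" using assms(4) by force
      then show "2 * d j = 2 / a j * (a j * d j)" by simp
    qed
    \<comment> \<open>Each weighted local integral is at most the whole Dirichlet integral, as all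
      terms are nonnegative.\<close>
    also have "\<dots> \<le> (\<Sum>j=1..n. 2 / a j * (\<Sum>i=1..n. a i * d i))"
    proof (intro sum_mono mult_left_mono)
      fix j assume j: "j \<in> {1..n}"
      show "a j * d j \<le> (\<Sum>i=1..n. a i * d i)"
        using assms(4) d_nonneg j by (intro member_le_sum) (auto simp: less_imp_le)
      show "0 \<le> 2 / a j" using assms(4) j by (simp add: less_imp_le)
    qed
    also have "\<dots> = S * enn2real (dirichlet_integral \<mu> f)"
      unfolding S_def D sum_distrib_right ..
    finally have le: "(\<Sum>x\<in>l ` {1..n}. 2 * enn2real (local_dirichlet_integral x f)) \<le>
        S * enn2real (dirichlet_integral \<mu> f)" .
    obtain g p where "decomposition n l f p g"
      "(hardy_norm g)\<^sup>2 \<le> W * (\<Sum>x\<in>l ` {1..n}. 2 * enn2real (local_dirichlet_integral x f))"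
      unfolding W_def using decomposition_exists[OF assms(1) l inj hol fin] .
    then show ?thesis
      using mult_left_mono[OF le W] by (meson order_trans)
  qed
  show ?thesis
  proof (intro conjI)
    show "\<forall>f. f holomorphic_on disc \<longrightarrow> (f \<in> dirichlet_space \<mu> \<longleftrightarrow> (\<exists>g p. decomposition n l f p g))"
      using exists space_iff local_dirichlet_integral_decomposition_finite[OF l inj] by metis
    show "\<forall>f g p h q. decomposition n l f p g \<and> decomposition n l f q h \<longrightarrow>
            p = q \<and> (\<forall>z\<in>disc. g z = h z)"
      using decomposition_unique[OF assms(1) l inj] by blast
    show "\<exists>C>0. \<forall>f\<in>dirichlet_space \<mu>. \<forall>g p. decomposition n l f p g \<longrightarrow>
            hardy_norm g \<le> C * dirichlet_norm \<mu> f"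
    proof (intro exI conjI ballI allI impI)
      \<comment> \<open>The added 1 yields a positive constant from \<open>W\<close> and
        \<open>S\<close> being nonnegative.\<close>
      show "0 < sqrt (W * S) + 1" using W S by (simp add: add_nonneg_pos)
      fix f g p assume f: "f \<in> dirichlet_space \<mu>" and dec: "decomposition n l f p g"
      let ?D = "enn2real (dirichlet_integral \<mu> f)"
      obtain h q where h: "decomposition n l f q h" "(hardy_norm h)\<^sup>2 \<le> W * (S * ?D)"
        using exists[OF f] by blast
      \<comment> \<open>Uniqueness transfers the bound from the constructed \<open>h\<close> to the
        given \<open>g\<close>.\<close>
      have "hardy_norm g = hardy_norm h"
        by (rule hardy_norm_cong) (rule decomposition_unique(2)[OF assms(1) l inj dec h(1)])
      also have "\<dots> \<le> sqrt (W * S * ?D)"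
        using h(2) by (intro real_le_rsqrt) (simp add: mult.assoc)
      also have "\<dots> = sqrt (W * S) * sqrt ?D"
        by (rule real_sqrt_mult)
      \<comment> \<open>The Dirichlet integral is one of the two nonnegative summands in the squared
        norm of \<open>f\<close>.\<close>
      also have "\<dots> \<le> (sqrt (W * S) + 1) * dirichlet_norm \<mu> f"
        unfolding dirichlet_norm_def using W S by (intro mult_mono) auto
      finally show "hardy_norm g \<le> (sqrt (W * S) + 1) * dirichlet_norm \<mu> f" .
    qed
  qed
qed

end
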